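(* Let $\{X_t,t\ge0\}$ be an irreducible time-homogeneous continuous-time Markov jump process on a general state space $(E,\mathcal{B})$, with transition function $P_t=(P_t(x,A))_{x\in E,A\in\mathcal{B}}$, stationary distribution $\pi$, and totally stable, conservative and regular $q$-pair $(q(x),q(x,A))$. Assume that $X_t$ has an $\mathcal{L}^2(\pi)$-spectral gap $\lambda(q)$ (that is, $\lambda(q)>0$), and that the set $\mathcal{K}$ of all functions on $E$ with finite support is dense in $\mathcal{D}(D^* )$ with respect to the norm $\|\cdot\|_{D^*}$. Then for any real numbers $a<b$, any bounded continuous function $g:E\to[a,b]$, and any $t,\varepsilon>0$, $$\mathbb{P}_{\pi}\left(\frac{1}{t}\int_0^t g(X_s)\,\mathrm{d}s-\pi(g)\ge\varepsilon\right)\le\exp\left\{-\frac{\lambda(q)\,t\,\varepsilon^2}{(b-a)^2}\right\}.$$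
   Context: $E$ is a topological space with $\sigma$-algebra $\mathcal{B}$ (Borel, containing singletons). Irreducibility is in the standard sense for general state spaces ($\varphi$-irreducibility). The process is a jump process, i.e. $P_t$ is continuous at the origin: $\lim_{t\to0}P_t(x,\{x\})=1$ for all $x\in E$. It has $q$-pair $(q(x),q(x,A))$ if $$\lim_{t\to0}\frac{P_t(x,A)-\mathbf{1}_{\{x\in A\}}}{t}=q(x,A)-q(x)\mathbf{1}_{\{x\in A\}},\qquad x\in E,\ A\in\mathcal{B}.$$ The $q$-pair is totally stable if $q(x)<\infty$ for all $x$, conservative if $q(x)=q(x,E)$ for all $x$, and regular if moreover the minimal process is non-explosive, so that the $q$-process is unique. $\mathbb{P}_\pi$ is the law of the process with initial distribution $\pi$, and $\pi(f)=\int_E f\,\mathrm{d}\pi$. $\mathcal{L}^2(\pi)=\{f:\pi(f^2)<\infty\}$ (real functions), $\langle f,h\rangle_\pi=\pi(fh)$, $\|f\|_{\pi,2}=\pi(f^2)^{1/2}$. The generator of $P_t$ (acting as a semigroup on $\mathcal{L}^2(\pi)$) is $\mathcal{A}f=\lim_{t\to0^+}(P_tf-f)/t$ in $\mathcal{L}^2(\pi)$, with domain $\mathcal{D}(\mathcal{A})$ the set of $f\in\mathcal{L}^2(\pi)$ for which this limit exists in $\mathcal{L}^2(\pi)$. Set $$\lambda(q):=\inf\{-\langle\mathcal{A}f,f\rangle_\pi:f\in\mathcal{D}(\mathcal{A}),\ \|f\|_{\pi,2}=1,\ \pi(f)=0\};$$ if $\lambda(q)>0$ it is called the $\mathcal{L}^2(\pi)$-spectral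 gap of $X_t$. Define $D^*(f)=\frac12\int_{x,y\in E}\pi(\mathrm{d}x)q(x,\mathrm{d}y)(f(x)-f(y))^2$ for $f\in\mathcal{L}^2(\pi)$, $\mathcal{D}(D^* )=\{f\in\mathcal{L}^2(\pi):D^*(f)<\infty\}$, and $\|f\|_{D^*}^2=\|f\|_{\pi,2}^2+D^*(f)$. *)

theory Defs
  imports "HOL-Probability.Probability"
begin

section \<open>Transition functions and $q$-pairs\<close>

definition transition_function :: "(real \<Rightarrow> 'e::topological_space \<Rightarrow> 'e measure) \<Rightarrow> bool" where
  "transition_function P \<longleftrightarrow>
     (\<forall>t\<ge>0. P t \<in> borel \<rightarrow>\<^sub>M prob_algebra borel) \<and>
     (\<forall>x. P 0 x = return borel x) \<and>
     (\<forall>s\<ge>0. \<forall>t\<ge>0. \<forall>x. P (s + t) x = P s x \<bind> P t)"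

definition jump_transition_function :: "(real \<Rightarrow> 'e::topological_space \<Rightarrow> 'e measure) \<Rightarrow> bool" where
  "jump_transition_function P \<longleftrightarrow>
     transition_function P \<and>
     (\<forall>x. ((\<lambda>t. measure (P t x) {x}) \<longlongrightarrow> 1) (at_right 0))"

text \<open>
  \<open>\<phi>\<close>-irreducibility on a general state space. The integral is the expected total time spent
  in \<open>A\<close> by the process started at \<open>x\<close>.
\<close>

definition irreducible_transition :: "(real \<Rightarrow> 'e::topological_space \<Rightarrow> 'e measure) \<Rightarrow> bool" where
  "irreducible_transition P \<longleftrightarrow>
     (\<exists>\<phi>. sigma_finite_measure \<phi> \<and> sets \<phi> = sets borel \<and> emeasure \<phi> UNIV \<noteq> 0 \<and>
        (\<forall>A\<in>sets borel. emeasure \<phi> A > 0 \<longrightarrow>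
           (\<forall>x. (\<integral>\<^sup>+t\<in>{0..}. emeasure (P t x) A \<partial>lborel) > 0)))"

definition stationary_distribution ::
  "(real \<Rightarrow> 'e::topological_space \<Rightarrow> 'e measure) \<Rightarrow> 'e measure \<Rightarrow> bool" where
  "stationary_distribution P \<pi> \<longleftrightarrow>
     prob_space \<pi> \<and> sets \<pi> = sets borel \<and> (\<forall>t\<ge>0. \<pi> \<bind> P t = \<pi>)"

text \<open>
  A \<open>q\<close>-pair \<open>(q(x), q(x,A))\<close> is given by \<open>q x\<close> and the measure \<open>Q x\<close>. Both are allowed to be
  infinite, so that total stability is a genuine condition.
\<close>

definition has_q_pair ::
  "(real \<Rightarrow> 'e::topological_space \<Rightarrow> 'e measure) \<Rightarrow> ('e \<Rightarrow> ennreal) \<Rightarrow> ('e \<Rightarrow> 'e measure) \<Rightarrow> bool" where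
  "has_q_pair P q Q \<longleftrightarrow>
     q \<in> borel_measurable borel \<and>
     (\<forall>x. sets (Q x) = sets borel) \<and>
     (\<forall>A\<in>sets borel. (\<lambda>x. emeasure (Q x) A) \<in> borel_measurable borel) \<and>
     (\<forall>x. \<forall>A\<in>sets borel.
        ((\<lambda>t. ereal ((measure (P t x) A - indicator A x) / t)) \<longlongrightarrow>
           enn2ereal (emeasure (Q x) A) - enn2ereal (q x) * indicator A x) (at_right 0))"

definition totally_stable :: "('e \<Rightarrow> ennreal) \<Rightarrow> bool" where
  "totally_stable q \<longleftrightarrow> (\<forall>x. q x < \<infinity>)"

definition conservative :: "('e \<Rightarrow> ennreal) \<Rightarrow> ('e \<Rightarrow> 'e measure) \<Rightarrow> bool" where
  "conservative q Q \<longleftrightarrow> (\<forall>x. q x = emeasure (Q x) UNIV)"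

text \<open>
  \<open>minimal_n_jumps q Q n t x A\<close> is the probability that the minimal process started at \<open>x\<close> makes
  exactly \<open>n\<close> jumps up to time \<open>t\<close> and is in \<open>A\<close> at time \<open>t\<close>. Summing over \<open>n\<close> gives the minimal
  nonnegative solution of the integrated backward Kolmogorov equation. This is used for totally
  stable pairs only, where \<open>enn2real (q x)\<close> is the value of \<open>q x\<close>.
\<close>

primrec minimal_n_jumps ::
  "('e \<Rightarrow> ennreal) \<Rightarrow> ('e \<Rightarrow> 'e measure) \<Rightarrow> nat \<Rightarrow> real \<Rightarrow> 'e \<Rightarrow> 'e set \<Rightarrow> ennreal" where
  "minimal_n_jumps q Q 0 t x A = ennreal (exp (- enn2real (q x) * t)) * indicator A x"
| "minimal_n_jumps q Q (Suc n) t x A =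
     (\<integral>\<^sup>+s\<in>{0..t}. ennreal (exp (- enn2real (q x) * s)) *
        (\<integral>\<^sup>+y. minimal_n_jumps q Q n (t - s) y A \<partial>Q x) \<partial>lborel)"

definition minimal_transition ::
  "('e \<Rightarrow> ennreal) \<Rightarrow> ('e \<Rightarrow> 'e measure) \<Rightarrow> real \<Rightarrow> 'e \<Rightarrow> 'e set \<Rightarrow> ennreal" where
  "minimal_transition q Q t x A = (\<Sum>n. minimal_n_jumps q Q n t x A)"

definition regular_q_pair :: "('e \<Rightarrow> ennreal) \<Rightarrow> ('e \<Rightarrow> 'e measure) \<Rightarrow> bool" where
  "regular_q_pair q Q \<longleftrightarrow>
     totally_stable q \<and> conservative q Q \<and>
     (\<forall>t\<ge>0. \<forall>x. minimal_transition q Q t x UNIV = 1)"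

section \<open>The process\<close>

definition natural_filtration ::
  "'w measure \<Rightarrow> (real \<Rightarrow> 'w \<Rightarrow> 'e::topological_space) \<Rightarrow> real \<Rightarrow> 'w measure" where
  "natural_filtration M X s =
     sigma (space M) {X u -` A \<inter> space M | u A. 0 \<le> u \<and> u \<le> s \<and> A \<in> sets borel}"

text \<open>
  \<open>X\<close>, indexed by times \<open>t \<ge> 0\<close>, has law \<open>\<P>\<^sub>\<mu>\<close> under \<open>M\<close>: initial distribution \<open>\<mu>\<close> and the
  time-homogeneous Markov property with transition function \<open>P\<close>. Of the sample paths only joint
  measurability in time and chance is required; it makes time integrals along paths meaningful and
  holds in particular for right-continuous piecewise constant paths.
\<close>

definition markov_process ::
  "'w measure \<Rightarrow> (real \<Rightarrow> 'w \<Rightarrow> 'e::topological_space) \<Rightarrow> (real \<Rightarrow> 'e \<Rightarrow> 'e measure) \<Rightarrow> 'e measure \<Rightarrow> bool"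
where
  "markov_process M X P \<mu> \<longleftrightarrow>
     prob_space M \<and>
     (\<lambda>(s, \<omega>). X s \<omega>) \<in> restrict_space borel {0..} \<Otimes>\<^sub>M M \<rightarrow>\<^sub>M borel \<and>
     distr M borel (X 0) = \<mu> \<and>
     (\<forall>s\<ge>0. \<forall>t\<ge>0. \<forall>A\<in>sets borel.
        AE \<omega> in M. real_cond_exp M (natural_filtration M X s) (\<lambda>\<omega>. indicator A (X (s + t) \<omega>)) \<omega>
          = measure (P t (X s \<omega>)) A)"

section \<open>The semigroup on $L^2(\pi)$ and its spectral gap\<close>

text \<open>Elements of $L^2(\pi)$ are represented by functions; \<open>L2_norm\<close> is a seminorm on these.\<close>

definition L2 :: "'e measure \<Rightarrow> ('e \<Rightarrow> real) set" where
  "L2 \<pi> = {f \<in> borel_measurable \<pi>. integrable \<pi> (\<lambda>x. (f x)\<^sup>2)}"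

definition L2_inner :: "'e measure \<Rightarrow> ('e \<Rightarrow> real) \<Rightarrow> ('e \<Rightarrow> real) \<Rightarrow> real" where
  "L2_inner \<pi> f h = (\<integral>x. f x * h x \<partial>\<pi>)"

definition L2_norm :: "'e measure \<Rightarrow> ('e \<Rightarrow> real) \<Rightarrow> real" where
  "L2_norm \<pi> f = sqrt (\<integral>x. (f x)\<^sup>2 \<partial>\<pi>)"

text \<open>
  For \<open>f\<close> in $L^2(\pi)$ with \<open>\<pi>\<close> stationary, the integral exists for \<open>\<pi>\<close>-almost all \<open>x\<close> only;
  elsewhere its value is \<open>0\<close>.
\<close>

definition semigroup_op ::
  "(real \<Rightarrow> 'e \<Rightarrow> 'e measure) \<Rightarrow> real \<Rightarrow> ('e \<Rightarrow> real) \<Rightarrow> 'e \<Rightarrow> real" where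
  "semigroup_op P t f x = (\<integral>y. f y \<partial>P t x)"

text \<open>\<open>generator P \<pi> f h\<close>: \<open>f\<close> is in the domain of the generator and its image is (the class of) \<open>h\<close>.\<close>

definition generator ::
  "(real \<Rightarrow> 'e \<Rightarrow> 'e measure) \<Rightarrow> 'e measure \<Rightarrow> ('e \<Rightarrow> real) \<Rightarrow> ('e \<Rightarrow> real) \<Rightarrow> bool" where
  "generator P \<pi> f h \<longleftrightarrow>
     f \<in> L2 \<pi> \<and> h \<in> L2 \<pi> \<and>
     ((\<lambda>t. L2_norm \<pi> (\<lambda>x. (semigroup_op P t f x - f x) / t - h x)) \<longlongrightarrow> 0) (at_right 0)"

text \<open>
  The infimum is taken in the extended reals: it is \<open>\<infinity>\<close> if \<open>\<pi>\<close> is trivial, when no admissible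
  \<open>f\<close> exists.
\<close>

definition spectral_gap :: "(real \<Rightarrow> 'e \<Rightarrow> 'e measure) \<Rightarrow> 'e measure \<Rightarrow> ereal" where
  "spectral_gap P \<pi> =
     Inf {ereal (- L2_inner \<pi> h f) | f h. generator P \<pi> f h \<and> L2_norm \<pi> f = 1 \<and> (\<integral>x. f x \<partial>\<pi>) = 0}"

definition exp_ereal :: "ereal \<Rightarrow> ereal" where
  "exp_ereal z = (if z = \<infinity> then \<infinity> else if z = -\<infinity> then 0 else ereal (exp (real_of_ereal z)))"

section \<open>The form $D^*$\<close>

definition Dstar :: "'e measure \<Rightarrow> ('e \<Rightarrow> 'e measure) \<Rightarrow> ('e \<Rightarrow> real) \<Rightarrow> ennreal" where
  "Dstar \<pi> Q f = (\<integral>\<^sup>+x. (\<integral>\<^sup>+y. ennreal ((f x - f y)\<^sup>2) \<partial>Q x) \<partial>\<pi>) / 2"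

definition Dstar_dom :: "'e measure \<Rightarrow> ('e \<Rightarrow> 'e measure) \<Rightarrow> ('e \<Rightarrow> real) set" where
  "Dstar_dom \<pi> Q = {f \<in> L2 \<pi>. Dstar \<pi> Q f < \<infinity>}"

text \<open>Used on \<open>Dstar_dom \<pi> Q\<close> only, where \<open>enn2real\<close> does not change the value.\<close>

definition Dstar_norm :: "'e measure \<Rightarrow> ('e \<Rightarrow> 'e measure) \<Rightarrow> ('e \<Rightarrow> real) \<Rightarrow> real" where
  "Dstar_norm \<pi> Q f = sqrt ((L2_norm \<pi> f)\<^sup>2 + enn2real (Dstar \<pi> Q f))"

definition finite_support_funs :: "('e \<Rightarrow> real) set" where
  "finite_support_funs = {f. finite {x. f x \<noteq> 0}}"

definition finite_support_dense :: "'e measure \<Rightarrow> ('e \<Rightarrow> 'e measure) \<Rightarrow> bool" where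
  "finite_support_dense \<pi> Q \<longleftrightarrow>
     (\<forall>f \<in> Dstar_dom \<pi> Q. \<forall>\<delta>>0. \<exists>h \<in> finite_support_funs \<inter> Dstar_dom \<pi> Q.
        Dstar_norm \<pi> Q (\<lambda>x. f x - h x) < \<delta>)"

end

theory Submission
  imports Defs "HOL-Real_Asymp.Real_Asymp"
begin

text \<open>
  Let \<open>\<lambda>(q)\<close> be the spectral gap, and replace \<open>g\<close> by \<open>G = \<theta>(g - \<pi>(g))\<close>, whose values lie in an interval of length
  \<open>R = \<theta>(b - a)\<close>. By Chernoff's bound everything reduces to
  \<open>E exp(\<integral>\<^sub>0\<^sup>t G(X\<^sub>s) ds) \<le> exp(t R\<^sup>2 / (4 \<lambda>(q)))\<close> (lemma \<open>exponential_moment\<close>), because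
  \<open>\<theta> = 2 \<lambda>(q) \<epsilon> / (b - a)\<^sup>2\<close> then minimizes the exponent.

  The heuristic reason is a bound on the quadratic form of the Feynman--Kac generator \<open>\<A> + G\<close>. For
  \<open>\<parallel>f\<parallel> = 1\<close> the gap gives \<open>\<langle>\<A>f, f\<rangle> \<le> -\<lambda>(q) v\<^sup>2\<close> with \<open>v\<^sup>2 = 1 - \<pi>(f)\<^sup>2\<close>, and \<open>\<pi>(G f\<^sup>2) \<le> R v\<close>, since
  \<open>G\<close> has mean zero and the total variation distance between \<open>f\<^sup>2\<pi>\<close> and \<open>\<pi>\<close> is at most their
  Hellinger-type distance \<open>v\<close> (lemma \<open>tilted_mean_le\<close>). Hence
  \<open>\<langle>(\<A> + G)f, f\<rangle> \<le> R v - \<lambda>(q) v\<^sup>2 \<le> R\<^sup>2 / (4 \<lambda>(q))\<close>.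

  The proof carries this out in discrete time, with steps of length \<open>d = t / n\<close> and the operators
  \<open>h \<mapsto> P\<^sub>d(e\<^sup>d\<^sup>G h)\<close>, so that only bounded functions occur. Three points need care.

  \<^item> The gap is defined through the generator, whereas the discrete argument uses
    \<open>Var(P\<^sub>d f) \<le> exp(-2 \<lambda>(q) d) Var(f)\<close> (lemma \<open>variance_decay\<close>). For a jump process
    \<open>t \<mapsto> P\<^sub>t f(x)\<close> is continuous, so the averages of \<open>P\<^sub>r f\<close> over \<open>r \<in> [0, s]\<close> lie in the domain of
    the generator. Along them \<open>\<parallel>P\<^sub>t f\<parallel>\<^sup>2\<close> satisfies a differential inequality, and \<open>s \<rightarrow> 0\<close> recovers \<open>f\<close>.
  \<^item> The paths of \<open>X\<close> are only jointly measurable, so Riemann sums along a fixed grid need not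
    converge to the time integral. But the time integral is exactly the mean of the Riemann sums over
    a uniformly distributed shift of the grid, and Jensen's inequality lets this mean pass through the
    exponential function. By stationarity every shifted grid satisfies the same bound.
  \<^item> The gap may be infinite. The bound is therefore proved for every positive real number
    \<open>\<gamma> \<le> \<lambda>(q)\<close>, and an infinite gap is treated by \<open>\<gamma> \<rightarrow> \<infinity>\<close>.
\<close>

section \<open>Uniform averages and bounded convergence\<close>

text \<open>
  Realizing the uniform distribution on a space whose only points are those of \<open>[0, 1]\<close> keeps all times
  \<open>a + c r\<close> with \<open>a, c \<ge> 0\<close> nonnegative; transition kernels and paths at negative times are arbitrary.
\<close>

definition unif01 :: "real measure" where
  "unif01 = restrict_space lborel {0..1}"

lemma space_unif01 [simp]: "space unif01 = {0..1}"
  by (simp add: unif01_def space_restrict_space)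

lemma sets_unif01 [measurable_cong]: "sets unif01 = sets (restrict_space borel {0..1})"
  by (simp add: unif01_def sets_restrict_space)

lemma prob_space_unif01: "prob_space unif01"
  by (rule prob_spaceI) (simp add: unif01_def space_restrict_space emeasure_restrict_space)

interpretation unif01: prob_space unif01
  by (rule prob_space_unif01)

lemma borel_measurable_unif01: "f \<in> measurable borel N \<Longrightarrow> f \<in> measurable unif01 N"
  by (simp add: measurable_cong_sets[OF sets_unif01 refl] measurable_restrict_space1)

lemma affine_measurable_unif01 [measurable]: "(\<lambda>r::real. a + c * r) \<in> borel_measurable unif01"
  by (rule borel_measurable_unif01) measurable

text \<open>
  Links expectations over a uniform time to Henstock--Kurzweil integrals, for which splitting an interval
  and the fundamental theorem of calculus are available.
\<close>

lemma integral_unif01_affine: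
  fixes Y :: "real \<Rightarrow> real"
  assumes m: "set_borel_measurable borel {a..a+c} Y"
    and B: "\<And>s. s \<in> {a..a+c} \<Longrightarrow> \<bar>Y s\<bar> \<le> B" and c: "0 < c"
  shows "set_integrable lborel {a..a+c} Y"
    and "(\<integral>r. Y (a + c * r) \<partial>unif01) = integral {a..a+c} Y / c"
proof -
  have B0: "0 \<le> B" using B[of a] c by (auto intro: order_trans[OF abs_ge_zero])
  show *: "set_integrable lborel {a..a+c} Y"
    unfolding set_integrable_def
  proof (rule Bochner_Integration.integrable_bound)
    show "integrable lborel (\<lambda>s. B * indicator {a..a+c} s)"
      by (intro integrable_mult_right integrable_real_indicator) (auto simp: emeasure_lborel_Icc_eq)
    show "AE s in lborel. norm (indicator {a..a+c} s *\<^sub>R Y s) \<le> norm (B * indicator {a..a+c} s)"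
      using B B0 by (auto simp: indicator_def intro!: AE_I2)
  qed (use assms(1) in \<open>simp add: set_borel_measurable_def\<close>)
  have eq: "indicator {0..1} r *\<^sub>R Y (a + c * r)
      = indicator {a..a+c} (a + c * r) *\<^sub>R Y (a + c * r)" for r
    using c by (auto simp: indicator_def mult_le_cancel_left1 zero_le_mult_iff)
  have "(\<integral>r. Y (a + c * r) \<partial>unif01) = (\<integral>r. indicator {0..1} r *\<^sub>R Y (a + c * r) \<partial>lborel)"
    by (simp add: unif01_def integral_restrict_space)
  also have "\<dots> = (\<integral>r. indicator {a..a+c} (a + c * r) *\<^sub>R Y (a + c * r) \<partial>lborel)"
    by (simp only: eq)
  also have "\<dots> = (LBINT s:{a..a+c}. Y s) / c"
    using lborel_integral_real_affine[of c "\<lambda>s. indicator {a..a+c} s *\<^sub>R Y s" a] c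
    by (simp add: set_lebesgue_integral_def field_simps)
  also have "(LBINT s:{a..a+c}. Y s) = integral {a..a+c} Y"
    by (rule set_borel_integral_eq_integral(2)[OF *])
  finally show "(\<integral>r. Y (a + c * r) \<partial>unif01) = integral {a..a+c} Y / c" .
qed

lemma (in finite_measure) bounded_integrable:
  fixes f :: "'a \<Rightarrow> real"
  assumes "f \<in> borel_measurable M" "\<And>x. x \<in> space M \<Longrightarrow> \<bar>f x\<bar> \<le> B"
  shows "integrable M f"
  using assms by (intro integrable_const_bound[where B=B]) auto

lemma (in prob_space) abs_integral_le_bound:
  fixes f :: "'a \<Rightarrow> real"
  assumes "f \<in> borel_measurable M" "\<And>x. x \<in> space M \<Longrightarrow> \<bar>f x\<bar> \<le> B"
  shows "\<bar>\<integral>x. f x \<partial>M\<bar> \<le> B"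
proof -
  have "\<bar>\<integral>x. f x \<partial>M\<bar> \<le> (\<integral>x. \<bar>f x\<bar> \<partial>M)" by (rule integral_abs_bound)
  also have "\<dots> \<le> (\<integral>x. B \<partial>M)"
    using assms bounded_integrable[OF assms]
    by (intro integral_mono) auto
  finally show ?thesis by (simp add: prob_space)
qed

lemma (in finite_measure) bounded_convergence_within:
  fixes f :: "real \<Rightarrow> 'a \<Rightarrow> real"
  assumes m: "\<And>t. t \<in> S \<Longrightarrow> f t \<in> borel_measurable M" "g \<in> borel_measurable M"
    and lim: "\<And>x. x \<in> space M \<Longrightarrow> ((\<lambda>t. f t x) \<longlongrightarrow> g x) (at a within S)"
    and B: "\<And>t x. t \<in> S \<Longrightarrow> t \<noteq> a \<Longrightarrow> x \<in> space M \<Longrightarrow> \<bar>f t x\<bar> \<le> B"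
  shows "((\<lambda>t. \<integral>x. f t x \<partial>M) \<longlongrightarrow> (\<integral>x. g x \<partial>M)) (at a within S)"
  unfolding tendsto_at_iff_sequentially comp_def
proof (intro allI impI)
  fix T :: "nat \<Rightarrow> real" assume T: "\<forall>i. T i \<in> S - {a}" "T \<longlonglongrightarrow> a"
  show "(\<lambda>i. \<integral>x. f (T i) x \<partial>M) \<longlonglongrightarrow> (\<integral>x. g x \<partial>M)"
  proof (rule integral_dominated_convergence[where w="\<lambda>_. B"])
    show "AE x in M. (\<lambda>i. f (T i) x) \<longlonglongrightarrow> g x"
      using lim T by (auto simp: tendsto_at_iff_sequentially comp_def intro!: AE_I2)
  qed (use T m B in auto)
qed

section \<open>An integral inequality for tilted measures\<close>

lemma (in prob_space) Cauchy_Schwarz_bounded: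
  fixes u v :: "'a \<Rightarrow> real"
  assumes [measurable]: "u \<in> borel_measurable M" "v \<in> borel_measurable M"
    and U: "\<And>x. x \<in> space M \<Longrightarrow> \<bar>u x\<bar> \<le> U" and V: "\<And>x. x \<in> space M \<Longrightarrow> \<bar>v x\<bar> \<le> V"
  shows "(\<integral>x. \<bar>u x * v x\<bar> \<partial>M)\<^sup>2 \<le> (\<integral>x. (u x)\<^sup>2 \<partial>M) * (\<integral>x. (v x)\<^sup>2 \<partial>M)"
proof -
  have bd: "\<bar>u x * v x\<bar> \<le> U * V" "(u x)\<^sup>2 \<le> U\<^sup>2" "(v x)\<^sup>2 \<le> V\<^sup>2" if "x \<in> space M" for x
    using power_mono[OF U[OF that], of 2] power_mono[OF V[OF that], of 2]
      mult_mono[OF U[OF that] V[OF that]] U[OF that] V[OF that] by (auto simp: abs_mult intro: order_trans[OF abs_ge_zero])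
  have i: "integrable M (\<lambda>x. \<bar>u x * v x\<bar>)" "integrable M (\<lambda>x. (u x)\<^sup>2)" "integrable M (\<lambda>x. (v x)\<^sup>2)"
    by (rule bounded_integrable[where B="U * V"], use bd in auto)
      (rule bounded_integrable[where B="U\<^sup>2"] bounded_integrable[where B="V\<^sup>2"], use bd in auto)+
  have "ennreal ((\<integral>x. \<bar>u x * v x\<bar> \<partial>M)\<^sup>2) = (\<integral>\<^sup>+x. ennreal \<bar>u x\<bar> * ennreal \<bar>v x\<bar> \<partial>M)\<^sup>2"
    using i(1) by (simp add: nn_integral_eq_integral abs_mult ennreal_mult[symmetric] ennreal_power)
  also have "\<dots> \<le> (\<integral>\<^sup>+x. (ennreal \<bar>u x\<bar>)\<^sup>2 \<partial>M) * (\<integral>\<^sup>+x. (ennreal \<bar>v x\<bar>)\<^sup>2 \<partial>M)"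
    by (rule Cauchy_Schwarz_nn_integral) auto
  also have "\<dots> = ennreal ((\<integral>x. (u x)\<^sup>2 \<partial>M) * (\<integral>x. (v x)\<^sup>2 \<partial>M))"
    using i(2,3) by (simp add: nn_integral_eq_integral ennreal_power ennreal_mult)
  finally show ?thesis by (simp add: ennreal_le_iff)
qed

text \<open>
  With \<open>N = \<parallel>k\<parallel>\<close>, the mean zero of \<open>G\<close> allows subtracting \<open>N\<^sup>2\<close> from \<open>k\<^sup>2\<close> and the midpoint of its range from
  \<open>G\<close>. Then \<open>\<bar>k\<^sup>2 - N\<^sup>2\<bar> = \<bar>k - N\<bar> \<bar>k + N\<bar>\<close> and the Cauchy--Schwarz inequality finish the proof, as
  \<open>\<parallel>k - N\<parallel>\<^sup>2 \<parallel>k + N\<parallel>\<^sup>2 = 4 N\<^sup>2 (N\<^sup>2 - (\<integral>k)\<^sup>2)\<close>. For \<open>N = 1\<close> this is Le Cam's comparison of total variation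
  and Hellinger distance, applied to the measures with densities \<open>k\<^sup>2\<close> and \<open>1\<close>.
\<close>

lemma (in prob_space) tilted_mean_le:
  fixes G k :: "'a \<Rightarrow> real"
  assumes [measurable]: "G \<in> borel_measurable M" "k \<in> borel_measurable M"
    and G: "\<And>x. x \<in> space M \<Longrightarrow> G x \<in> {l..l + R}" "(\<integral>x. G x \<partial>M) = 0"
    and k: "\<And>x. x \<in> space M \<Longrightarrow> \<bar>k x\<bar> \<le> B"
  defines "A \<equiv> \<integral>x. (k x)\<^sup>2 \<partial>M"
  shows "(\<integral>x. k x \<partial>M)\<^sup>2 \<le> A" 
    and "(\<integral>x. G x * (k x)\<^sup>2 \<partial>M) \<le> R * sqrt A * sqrt (A - (\<integral>x. k x \<partial>M)\<^sup>2)"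
proof -
  define N where "N = sqrt A"
  define \<kappa> where "\<kappa> = (\<integral>x. k x \<partial>M)"
  have A: "0 \<le> A" by (simp add: A_def)
  have N2: "N\<^sup>2 = A" using A by (simp add: N_def)
  have N0: "0 \<le> N" using A by (simp add: N_def)
  have ik [simp]: "integrable M k" using k by (intro bounded_integrable[where B=B]) auto
  have k2: "(k x)\<^sup>2 \<le> B\<^sup>2" if "x \<in> space M" for x using power_mono[OF k[OF that], of 2] by simp
  have ik2 [simp]: "integrable M (\<lambda>x. (k x)\<^sup>2)"
    using k2 by (intro bounded_integrable[where B="B\<^sup>2"]) auto
  have bG: "\<bar>G x\<bar> \<le> \<bar>l\<bar> + \<bar>R\<bar>" if "x \<in> space M" for x using G(1)[OF that] by auto
  have iG [simp]: "integrable M G" using bG by (intro bounded_integrable[where B="\<bar>l\<bar> + \<bar>R\<bar>"]) auto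
  have iGk [simp]: "integrable M (\<lambda>x. G x * (k x)\<^sup>2)"
    using bG k2 by (intro bounded_integrable[where B="(\<bar>l\<bar> + \<bar>R\<bar>) * B\<^sup>2"])
      (auto simp: abs_mult intro!: mult_mono)
  have sq: "(\<integral>x. (k x + c)\<^sup>2 \<partial>M) = A + 2 * c * \<kappa> + c\<^sup>2" for c
    by (simp add: power2_sum A_def \<kappa>_def prob_space mult.assoc mult.commute[of _ c])
  have "0 \<le> (\<integral>x. (k x + (- \<kappa>))\<^sup>2 \<partial>M)" by simp
  then have "0 \<le> A + 2 * (- \<kappa>) * \<kappa> + (- \<kappa>)\<^sup>2" by (simp only: sq)
  then show var: "(\<integral>x. k x \<partial>M)\<^sup>2 \<le> A" by (simp add: \<kappa>_def power2_eq_square)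
  define m where "m = l + R / 2"
  have le: "\<bar>G x - m\<bar> \<le> R / 2" if "x \<in> space M" for x
    using G(1)[OF that] by (auto simp: m_def abs_le_iff field_simps)
  have R: "0 \<le> R" using G(1) not_empty by fastforce
  let ?D = "\<integral>x. \<bar>(k x + (- N)) * (k x + N)\<bar> \<partial>M"
  have iD: "integrable M (\<lambda>x. \<bar>(k x + (- N)) * (k x + N)\<bar>)"
    by (simp add: algebra_simps power2_eq_square[symmetric])
  have "(\<integral>x. G x * (k x)\<^sup>2 \<partial>M) = (\<integral>x. (G x - m) * ((k x)\<^sup>2 - N\<^sup>2) \<partial>M)"
    by (simp add: algebra_simps G(2) prob_space) (simp add: N2 A_def)
  also have "\<dots> \<le> (\<integral>x. R / 2 * \<bar>(k x + (- N)) * (k x + N)\<bar> \<partial>M)"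
  proof (rule integral_mono)
    fix x assume x: "x \<in> space M"
    have "(G x - m) * ((k x)\<^sup>2 - N\<^sup>2) \<le> \<bar>G x - m\<bar> * \<bar>(k x)\<^sup>2 - N\<^sup>2\<bar>"
      by (simp add: abs_mult[symmetric])
    also have "\<dots> \<le> R / 2 * \<bar>(k x)\<^sup>2 - N\<^sup>2\<bar>" using le[OF x] by (intro mult_right_mono) auto
    also have "\<bar>(k x)\<^sup>2 - N\<^sup>2\<bar> = \<bar>(k x + (- N)) * (k x + N)\<bar>"
      by (simp add: power2_eq_square algebra_simps)
    finally show "(G x - m) * ((k x)\<^sup>2 - N\<^sup>2) \<le> R / 2 * \<bar>(k x + (- N)) * (k x + N)\<bar>" .
  qed (use iD in \<open>auto simp: algebra_simps\<close>)
  also have "\<dots> = R / 2 * ?D" by simp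
  also have "\<dots> \<le> R / 2 * (2 * N * sqrt (A - \<kappa>\<^sup>2))"
  proof (rule mult_left_mono)
    have "?D\<^sup>2 \<le> (\<integral>x. (k x + (- N))\<^sup>2 \<partial>M) * (\<integral>x. (k x + N)\<^sup>2 \<partial>M)"
    proof (rule Cauchy_Schwarz_bounded[where U="B + N" and V="B + N"])
      fix x assume "x \<in> space M"
      then show "\<bar>k x + - N\<bar> \<le> B + N" "\<bar>k x + N\<bar> \<le> B + N" using k[of x] N0 by auto
    qed auto
    also have "\<dots> = (2 * N)\<^sup>2 * (A - \<kappa>\<^sup>2)"
      unfolding sq by (simp add: N2[symmetric]) (simp add: power2_eq_square algebra_simps)
    finally have "sqrt (?D\<^sup>2) \<le> sqrt ((2 * N)\<^sup>2 * (A - \<kappa>\<^sup>2))" by (rule real_sqrt_le_mono)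
    moreover have "0 \<le> ?D" by simp
    ultimately show "?D \<le> 2 * N * sqrt (A - \<kappa>\<^sup>2)"
      using N0 by (simp only: real_sqrt_mult real_sqrt_abs abs_of_nonneg mult_nonneg_nonneg zero_le_numeral)
  qed (use R in simp)
  finally show "(\<integral>x. G x * (k x)\<^sup>2 \<partial>M) \<le> R * sqrt A * sqrt (A - (\<integral>x. k x \<partial>M)\<^sup>2)"
    by (simp add: N_def \<kappa>_def)
qed

lemma weighted_AM_GM:
  fixes \<beta> :: real
  assumes "0 < \<beta>"
  shows "2 * x * y \<le> \<beta> * y\<^sup>2 + x\<^sup>2 / \<beta>"
proof -
  have "0 \<le> (\<beta> * y - x)\<^sup>2 / \<beta>" using assms by simp
  also have "\<dots> = \<beta> * y\<^sup>2 + x\<^sup>2 / \<beta> - 2 * x * y"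
    using assms by (simp add: power2_eq_square field_simps)
  finally show ?thesis by simp
qed

section \<open>The semigroup on bounded functions\<close>

locale stationary_jump_semigroup =
  fixes P :: "real \<Rightarrow> 'e::topological_space \<Rightarrow> 'e measure" and \<pi> :: "'e measure"
  assumes singleton_borel: "\<And>x::'e. {x} \<in> sets borel"
    and jump: "jump_transition_function P"
    and stationary: "stationary_distribution P \<pi>"
begin

abbreviation op :: "real \<Rightarrow> ('e \<Rightarrow> real) \<Rightarrow> 'e \<Rightarrow> real" where
  "op \<equiv> semigroup_op P"

lemma kernel: "0 \<le> t \<Longrightarrow> P t \<in> borel \<rightarrow>\<^sub>M subprob_algebra borel"
  using jump by (auto simp: jump_transition_function_def transition_function_def
      intro: measurable_prob_algebraD)

lemma kernel_prob: assumes "0 \<le> t" shows "prob_space (P t x)"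
  using jump assms measurable_space[of "P t" borel "prob_algebra borel" x]
  by (auto simp: jump_transition_function_def transition_function_def space_prob_algebra)

lemma sets_kernel [measurable_cong]: "0 \<le> t \<Longrightarrow> sets (P t x) = sets borel"
  using sets_kernel[OF kernel, of t x] by simp

lemma space_kernel: "0 \<le> t \<Longrightarrow> space (P t x) = UNIV"
  using sets_eq_imp_space_eq[OF sets_kernel, of t x] by simp

lemma prob_stationary: "prob_space \<pi>"
  and sets_stationary [measurable_cong]: "sets \<pi> = sets borel"
  and bind_stationary: "0 \<le> t \<Longrightarrow> \<pi> \<bind> P t = \<pi>"
  using stationary by (auto simp: stationary_distribution_def)

lemma space_stationary [simp]: "space \<pi> = UNIV"
  using sets_eq_imp_space_eq[OF sets_stationary] by simp

sublocale stat: prob_space \<pi> by (rule prob_stationary)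

lemma measure_stationary_UNIV [simp]: "measure \<pi> UNIV = 1"
  using stat.prob_space by simp

lemma measurable_kernel: "f \<in> borel_measurable borel \<Longrightarrow> 0 \<le> t \<Longrightarrow> f \<in> borel_measurable (P t x)"
  by (simp add: measurable_cong_sets[OF sets_kernel])

lemma measurable_stationary: "f \<in> borel_measurable borel \<Longrightarrow> f \<in> borel_measurable \<pi>"
  by (simp add: measurable_cong_sets[OF sets_stationary])

lemma integrable_kernel:
  assumes "f \<in> borel_measurable borel" "\<And>x. \<bar>f x\<bar> \<le> B" "0 \<le> t"
  shows "integrable (P t x) (f :: 'e \<Rightarrow> real)"
proof -
  interpret prob_space "P t x" by (rule kernel_prob[OF assms(3)])
  show ?thesis using assms by (intro bounded_integrable[where B=B] measurable_kernel) auto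
qed

lemma integrable_stationary:
  assumes "f \<in> borel_measurable borel" "\<And>x. \<bar>f x\<bar> \<le> B"
  shows "integrable \<pi> (f :: 'e \<Rightarrow> real)"
  using assms by (intro stat.bounded_integrable[where B=B] measurable_stationary) auto

lemma op_measurable [measurable]:
  assumes "f \<in> borel_measurable borel" "0 \<le> t"
  shows "op t f \<in> borel_measurable borel"
  unfolding semigroup_op_def
  by (rule measurable_compose[OF kernel[OF assms(2)] integral_measurable_subprob_algebra[OF assms(1)]])

lemma op_bounded:
  assumes "f \<in> borel_measurable borel" "\<And>x. \<bar>f x\<bar> \<le> B" "0 \<le> t"
  shows "\<bar>op t f x\<bar> \<le> B"
proof -
  interpret prob_space "P t x" by (rule kernel_prob[OF assms(3)])
  show ?thesis unfolding semigroup_op_def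
    using assms by (intro abs_integral_le_bound measurable_kernel) auto
qed

lemma op_zero: "f \<in> borel_measurable borel \<Longrightarrow> op 0 f = f"
proof
  fix x assume "f \<in> borel_measurable borel"
  moreover have "P 0 x = return borel x"
    using jump by (simp add: jump_transition_function_def transition_function_def)
  ultimately show "op 0 f x = f x" by (simp add: semigroup_op_def integral_return)
qed

lemma op_semigroup:
  assumes f: "f \<in> borel_measurable borel" "\<And>x. \<bar>f x\<bar> \<le> B" and "0 \<le> s" "0 \<le> t"
  shows "op (s + t) f x = op s (op t f) x"
proof -
  have "P (s + t) x = P s x \<bind> P t"
    using jump assms by (simp add: jump_transition_function_def transition_function_def)
  moreover have "(\<integral>y. f y \<partial>(P s x \<bind> P t)) = (\<integral>y. (\<integral>z. f z \<partial>P t y) \<partial>P s x)"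
  proof (rule integral_bind[where K=borel and B'=1 and B=B])
    show "P t \<in> P s x \<rightarrow>\<^sub>M subprob_algebra borel"
      using kernel[OF \<open>0 \<le> t\<close>] by (simp add: measurable_cong_sets[OF sets_kernel[OF \<open>0 \<le> s\<close>]])
    show "finite_measure (P s x)"
      using kernel_prob[OF \<open>0 \<le> s\<close>] by (simp add: prob_space_def)
    show "AE y in P s x. emeasure (P t y) (space (P t y)) \<le> ennreal 1"
      using prob_space.emeasure_space_1[OF kernel_prob[OF \<open>0 \<le> t\<close>]] by simp
  qed (use assms space_kernel[OF \<open>0 \<le> s\<close>] in auto)
  ultimately show ?thesis by (simp add: semigroup_op_def)
qed

lemma stationary_op:
  assumes "f \<in> borel_measurable borel" "\<And>x. \<bar>f x\<bar> \<le> B" and "0 \<le> t"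
  shows "(\<integral>x. op t f x \<partial>\<pi>) = (\<integral>x. f x \<partial>\<pi>)"
proof -
  have "(\<integral>y. f y \<partial>(\<pi> \<bind> P t)) = (\<integral>y. (\<integral>z. f z \<partial>P t y) \<partial>\<pi>)"
  proof (rule integral_bind[where K=borel and B'=1 and B=B])
    show "P t \<in> \<pi> \<rightarrow>\<^sub>M subprob_algebra borel"
      using kernel[OF \<open>0 \<le> t\<close>] by (simp add: measurable_cong_sets[OF sets_stationary])
    show "AE y in \<pi>. emeasure (P t y) (space (P t y)) \<le> ennreal 1"
      using prob_space.emeasure_space_1[OF kernel_prob[OF \<open>0 \<le> t\<close>]] by simp
  qed (use assms stat.finite_measure_axioms in auto)
  then show ?thesis using bind_stationary[OF assms(3)] by (simp add: semigroup_op_def)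
qed

text \<open>
  Starting from \<open>x\<close>, the values of \<open>f\<close> at time \<open>t\<close> and at time \<open>0\<close> differ only if the process has left
  \<open>x\<close>, and then by at most \<open>2B\<close>.
\<close>

lemma op_displacement:
  assumes f: "f \<in> borel_measurable borel" "\<And>x. \<bar>f x\<bar> \<le> B" and t: "0 \<le> t"
  shows "\<bar>op t f x - f x\<bar> \<le> 2 * B * (1 - measure (P t x) {x})"
proof -
  interpret p: prob_space "P t x" by (rule kernel_prob[OF t])
  note [measurable] = f(1) singleton_borel
  have i: "integrable (P t x) f" by (rule integrable_kernel[OF f t])
  have si: "- {x} \<in> sets (P t x)" by (simp add: sets_kernel[OF t] singleton_borel borel_comp)
  have "op t f x - f x = (\<integral>y. (f y - f x) \<partial>P t x)"
    using i by (simp add: semigroup_op_def p.prob_space)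
  also have "\<bar>\<dots>\<bar> \<le> (\<integral>y. \<bar>f y - f x\<bar> \<partial>P t x)" by (rule integral_abs_bound)
  also have "\<dots> \<le> (\<integral>y. 2 * B * indicator (- {x}) y \<partial>P t x)"
  proof (rule integral_mono)
    fix y show "\<bar>f y - f x\<bar> \<le> 2 * B * indicator (- {x}) y"
      using f(2)[of x] f(2)[of y] by (auto simp: indicator_def)
  qed (use i si in \<open>auto simp: p.emeasure_eq_measure\<close>)
  also have "\<dots> = 2 * B * measure (P t x) (- {x})"
    using si by (simp add: space_kernel[OF t])
  also have "measure (P t x) (- {x}) = 1 - measure (P t x) {x}"
    using p.prob_compl[of "{x}"] singleton_borel by (simp add: sets_kernel[OF t] space_kernel[OF t] Compl_eq_Diff_UNIV)
  finally show ?thesis .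
qed

text \<open>
  Applying \<open>op_displacement\<close> to \<open>op v f\<close>, which has the same bound as \<open>f\<close>, gives a modulus of continuity that
  depends on the time difference only. This makes continuity two-sided.
\<close>

lemma op_continuous_on:
  assumes f: "f \<in> borel_measurable borel" "\<And>x. \<bar>f x\<bar> \<le> B"
  shows "continuous_on {0..} (\<lambda>t. op t f x)"
  unfolding continuous_on_iff
proof (intro ballI allI impI)
  fix t e :: real assume t: "t \<in> {0..}" and e: "0 < e"
  have B: "0 \<le> B" using f(2)[of x] by (auto intro: order_trans[OF abs_ge_zero])
  have "((\<lambda>s. 2 * B * (1 - measure (P s x) {x})) \<longlongrightarrow> 2 * B * (1 - 1)) (at_right 0)"
    using jump by (intro tendsto_intros) (simp add: jump_transition_function_def)
  from order_tendstoD(2)[OF this, of e] e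
  obtain d where d: "d > 0" "\<And>s. 0 < s \<Longrightarrow> s < d \<Longrightarrow> 2 * B * (1 - measure (P s x) {x}) < e"
    by (auto simp: eventually_at_right_field)
  have key: "\<bar>op u f x - op v f x\<bar> < e" if "0 \<le> v" "v < u" "u - v < d" for u v
  proof -
    have "op u f x = op (u - v) (op v f) x" using op_semigroup[OF f, of "u - v" v x] that by simp
    then have "\<bar>op u f x - op v f x\<bar> \<le> 2 * B * (1 - measure (P (u - v) x) {x})"
      using op_displacement[of "op v f" B "u - v" x] op_bounded[OF f] op_measurable[OF f(1)] that by simp
    also have "\<dots> < e" using that by (intro d(2)) auto
    finally show ?thesis .
  qed
  have "dist (op u f x) (op t f x) < e" if "u \<ge> 0" "dist u t < d" for u
    using key[of t u] key[of u t] that t e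
    by (cases u t rule: linorder_cases) (auto simp: dist_real_def abs_minus_commute)
  then show "\<exists>d>0. \<forall>u\<in>{0..}. dist u t < d \<longrightarrow> dist (op u f x) (op t f x) < e"
    using d(1) by auto
qed

lemma op_tendsto:
  assumes f: "f \<in> borel_measurable borel" "\<And>x. \<bar>f x\<bar> \<le> B"
    and \<tau>: "(\<tau> \<longlongrightarrow> t) F" "0 \<le> t" "eventually (\<lambda>z. 0 \<le> \<tau> z) F"
  shows "((\<lambda>z. op (\<tau> z) f x) \<longlongrightarrow> op t f x) F"
  using continuous_on_tendsto_compose[OF op_continuous_on[OF f, of x] \<tau>(1)] \<tau> by simp

text \<open>
  Continuity in time reduces the claim to discretized times, which take countably many values.
\<close>

lemma op_jointly_measurable:
  assumes f: "f \<in> borel_measurable borel" "\<And>x. \<bar>f x\<bar> \<le> B"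
    and \<tau> [measurable]: "\<tau> \<in> borel_measurable N" and \<tau>0: "\<And>z. z \<in> space N \<Longrightarrow> 0 \<le> \<tau> z"
  shows "(\<lambda>(z, x). op (\<tau> z) f x) \<in> borel_measurable (N \<Otimes>\<^sub>M borel)"
proof (rule borel_measurable_LIMSEQ_real)
  \<comment> \<open>Rounding up keeps the discretized times nonnegative.\<close>
  let ?h = "\<lambda>n z. real (nat \<lceil>real (Suc n) * \<tau> z\<rceil>) / real (Suc n)"
  show "(\<lambda>n. (\<lambda>(z, x). op (?h n z) f x) zx) \<longlonglongrightarrow> (\<lambda>(z, x). op (\<tau> z) f x) zx"
    if zx: "zx \<in> space (N \<Otimes>\<^sub>M borel)" for zx
  proof -
    obtain z x where [simp]: "zx = (z, x)" by (cases zx)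
    have z: "0 \<le> \<tau> z" using zx \<tau>0 by (auto simp: space_pair_measure)
    have *: "\<bar>?h n z - \<tau> z\<bar> \<le> 1 / real (Suc n)" for n
    proof -
      have "real (nat \<lceil>real (Suc n) * \<tau> z\<rceil>) = of_int \<lceil>real (Suc n) * \<tau> z\<rceil>" using z by simp
      moreover have "real (Suc n) * \<tau> z \<le> of_int \<lceil>real (Suc n) * \<tau> z\<rceil>"
        "of_int \<lceil>real (Suc n) * \<tau> z\<rceil> \<le> real (Suc n) * \<tau> z + 1" by linarith+
      ultimately have "\<bar>real (nat \<lceil>real (Suc n) * \<tau> z\<rceil>) - real (Suc n) * \<tau> z\<bar> \<le> 1" by linarith
      moreover have "?h n z - \<tau> z = (real (nat \<lceil>real (Suc n) * \<tau> z\<rceil>) - real (Suc n) * \<tau> z) / real (Suc n)"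
        by (simp add: field_simps)
      ultimately show ?thesis by (simp only: abs_divide abs_of_nat divide_right_mono of_nat_0_le_iff)
    qed
    have "(\<lambda>n. ?h n z - \<tau> z) \<longlonglongrightarrow> 0"
      by (rule Lim_null_comparison[OF _ LIMSEQ_Suc[OF lim_1_over_n]]) (use * in \<open>auto intro!: always_eventually simp del: of_nat_Suc\<close>)
    then have "(\<lambda>n. ?h n z) \<longlonglongrightarrow> \<tau> z" by (simp only: LIM_zero_iff)
    moreover have "\<forall>n. 0 \<le> ?h n z" by (intro allI divide_nonneg_nonneg of_nat_0_le_iff)
    ultimately have "(\<lambda>n. op (?h n z) f x) \<longlonglongrightarrow> op (\<tau> z) f x"
      by (intro op_tendsto[OF f _ z] always_eventually)
    then show ?thesis by (simp only: \<open>zx = (z, x)\<close> case_prod_conv)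
  qed
  show "(\<lambda>(z, x). op (?h n z) f x) \<in> borel_measurable (N \<Otimes>\<^sub>M borel)" for n
  proof -
    have "(\<lambda>zx. op (real (nat \<lceil>real (Suc n) * \<tau> (fst zx)\<rceil>) / real (Suc n)) f (snd zx)) \<in> borel_measurable (N \<Otimes>\<^sub>M borel)"
    proof (rule measurable_compose_countable[where f="\<lambda>i zx. op (real i / real (Suc n)) f (snd zx)" and g="\<lambda>zx. nat \<lceil>real (Suc n) * \<tau> (fst zx)\<rceil>"])
      show "(\<lambda>zx. op (real i / real (Suc n)) f (snd zx)) \<in> borel_measurable (N \<Otimes>\<^sub>M borel)" for i
        using op_measurable[OF f(1), of "real i / real (Suc n)"] by (auto intro: measurable_compose[OF measurable_snd])
    qed measurable
    then show ?thesis by (simp add: case_prod_beta')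
  qed
qed

section \<open>The generator on time averages\<close>

text \<open>
  A smoothing of \<open>f\<close> in the sense of semigroup theory: these averages are the standard dense set of
  elements in the domain of the generator.
\<close>

definition time_average :: "real \<Rightarrow> ('e \<Rightarrow> real) \<Rightarrow> 'e \<Rightarrow> real" where
  "time_average s f x = (\<integral>r. op (s * r) f x \<partial>unif01)"

context
  fixes f :: "'e \<Rightarrow> real" and B :: real
  assumes f [measurable]: "f \<in> borel_measurable borel" and B: "\<And>x. \<bar>f x\<bar> \<le> B"
begin

lemma op_path_measurable:
  assumes "0 \<le> t" "0 \<le> s"
  shows "(\<lambda>r. op (t + s * r) f x) \<in> borel_measurable unif01"
proof -
  have "(\<lambda>(r, x). op (t + s * r) f x) \<in> borel_measurable (unif01 \<Otimes>\<^sub>M borel)"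
    using assms by (intro op_jointly_measurable[OF f B]) auto
  from measurable_Pair1[OF this, of x] show ?thesis by simp
qed

lemma time_average_measurable: "0 \<le> s \<Longrightarrow> time_average s f \<in> borel_measurable borel"
proof -
  assume s: "0 \<le> s"
  have "(\<lambda>(r, x). op (0 + s * r) f x) \<in> borel_measurable (unif01 \<Otimes>\<^sub>M borel)"
    using s affine_measurable_unif01[of 0 s] by (intro op_jointly_measurable[OF f B]) auto
  then have "(\<lambda>(x, r). op (s * r) f x) \<in> borel_measurable (borel \<Otimes>\<^sub>M unif01)"
    by (subst measurable_pair_swap_iff) (simp add: split_def)
  then show ?thesis unfolding time_average_def
    by (intro unif01.borel_measurable_lebesgue_integral)
qed

lemma time_average_bounded: "0 \<le> s \<Longrightarrow> \<bar>time_average s f x\<bar> \<le> B"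
  unfolding time_average_def using op_path_measurable[of 0 s x]
  by (intro unif01.abs_integral_le_bound op_bounded[OF f B]) auto

lemma integral_time_average:
  assumes s: "0 \<le> s" and \<mu>: "prob_space \<mu>" "sets \<mu> = sets borel"
  shows "(\<integral>x. time_average s f x \<partial>\<mu>) = (\<integral>r. (\<integral>x. op (s * r) f x \<partial>\<mu>) \<partial>unif01)"
proof -
  interpret \<mu>: prob_space \<mu> by fact
  interpret pair_prob_space unif01 \<mu> ..
  have "(\<lambda>(r, x). op (0 + s * r) f x) \<in> borel_measurable (unif01 \<Otimes>\<^sub>M borel)"
    using s affine_measurable_unif01[of 0 s] by (intro op_jointly_measurable[OF f B]) auto
  then have m: "(\<lambda>(r, x). op (s * r) f x) \<in> borel_measurable (unif01 \<Otimes>\<^sub>M \<mu>)"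
    by (simp add: measurable_cong_sets[OF sets_pair_measure_cong[OF refl \<mu>(2)] refl])
  show ?thesis unfolding time_average_def
  proof (rule Fubini_integral)
    show "integrable (unif01 \<Otimes>\<^sub>M \<mu>) (\<lambda>(r, x). op (s * r) f x)"
      using s by (intro P.bounded_integrable[OF m, where B=B])
        (auto simp: space_pair_measure intro!: op_bounded[OF f B])
  qed
qed

text \<open>
  Both claims are Fubini's theorem together with the semigroup property.
\<close>

lemma op_time_average:
  assumes "0 \<le> s" "0 \<le> t"
  shows "op t (time_average s f) x = (\<integral>r. op (t + s * r) f x \<partial>unif01)"
    and "op t (time_average s f) x = time_average s (op t f) x"
proof -
  show *: "op t (time_average s f) x = (\<integral>r. op (t + s * r) f x \<partial>unif01)"
    unfolding semigroup_op_def[of P t]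
    using integral_time_average[OF \<open>0 \<le> s\<close> kernel_prob[OF \<open>0 \<le> t\<close>] sets_kernel[OF \<open>0 \<le> t\<close>], of x] assms
    by (auto simp: op_semigroup[OF f B] semigroup_op_def[of P t] intro!: Bochner_Integration.integral_cong)
  show "op t (time_average s f) x = time_average s (op t f) x"
    unfolding * time_average_def using assms
    by (intro Bochner_Integration.integral_cong) (auto simp: op_semigroup[OF f B, symmetric] add.commute)
qed

lemma stationary_time_average: "0 \<le> s \<Longrightarrow> (\<integral>x. time_average s f x \<partial>\<pi>) = (\<integral>x. f x \<partial>\<pi>)"
proof -
  assume s: "0 \<le> s"
  have "(\<integral>x. time_average s f x \<partial>\<pi>) = (\<integral>r. (\<integral>x. f x \<partial>\<pi>) \<partial>unif01)"
    unfolding integral_time_average[OF s prob_stationary sets_stationary]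
    using s by (intro Bochner_Integration.integral_cong stationary_op[OF f B]) auto
  then show ?thesis using unif01.prob_space by simp
qed

lemma time_average_tendsto: "((\<lambda>s. time_average s f x) \<longlongrightarrow> f x) (at_right 0)"
proof -
  have "((\<lambda>s. time_average s f x) \<longlongrightarrow> (\<integral>r. f x \<partial>unif01)) (at_right 0)"
    unfolding time_average_def
  proof (rule unif01.bounded_convergence_within[where B=B])
    fix r :: real assume r: "r \<in> space unif01"
    have "((\<lambda>s. s * r) \<longlongrightarrow> 0 * r) (at_right 0)" by (intro tendsto_intros)
    then have "((\<lambda>s. op (s * r) f x) \<longlongrightarrow> op 0 f x) (at_right 0)"
      using r by (intro op_tendsto[OF f B]) (auto simp: eventually_at_right_field intro!: exI[of _ 1])
    then show "((\<lambda>s. op (s * r) f x) \<longlongrightarrow> f x) (at_right 0)" by (simp add: op_zero)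
  qed (use op_path_measurable[of 0 _ x] in \<open>auto intro!: op_bounded[OF f B]\<close>)
  then show ?thesis using unif01.prob_space by simp
qed

text \<open>
  The path \<open>t \<mapsto> P\<^sub>t (time_average s f)(x)\<close> equals \<open>1/s\<close> times the integral of the continuous function
  \<open>r \<mapsto> P\<^sub>r f(x)\<close> over the moving window \<open>[t, t + s]\<close>.
\<close>

lemma op_time_average_derivative:
  assumes s: "0 < s" and t: "0 \<le> t"
  shows "((\<lambda>t. op t (time_average s f) x) has_real_derivative (op (t + s) f x - op t f x) / s)
           (at t within {0..})"
proof -
  let ?u = "\<lambda>t. op t f x" and ?I = "\<lambda>v. integral {0..v} (\<lambda>t. op t f x)"
  note cont = op_continuous_on[OF f B, of x]
  have int: "?u integrable_on {v..w}" if "0 \<le> v" for v w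
    using that by (intro integrable_continuous_real continuous_on_subset[OF cont]) auto
  have dI: "(?I has_real_derivative ?u v) (at v within {0..})" if "0 \<le> v" for v
  proof -
    have "(?I has_real_derivative ?u v) (at v within {0..v+1})"
      using that by (intro integral_has_real_derivative continuous_on_subset[OF cont]) auto
    moreover have "at v within {0..v+1} = at v within {0..}"
      by (rule at_within_nhd[of v "{..<v+1}"]) auto
    ultimately show ?thesis by simp
  qed
  have "((\<lambda>t. ?I (t + s)) has_real_derivative ?u (t + s)) (at t within {0..})"
  proof -
    have "(?I has_real_derivative ?u (t + s)) (at (t + s) within (\<lambda>t. t + s) ` {0..})"
      by (rule DERIV_subset[OF dI]) (use s t in auto)
    moreover have "((\<lambda>t. t + s) has_real_derivative 1) (at t within {0..})"
      by (auto intro!: derivative_eq_intros)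
    ultimately show ?thesis
      using DERIV_image_chain[of ?I "?u (t + s)" "\<lambda>t. t + s" t "{0..}" 1] by (simp add: comp_def)
  qed
  then have D: "((\<lambda>t. (?I (t + s) - ?I t) / s) has_real_derivative (op (t + s) f x - op t f x) / s)
      (at t within {0..})"
    by (intro DERIV_cdivide DERIV_diff dI t)
  have eq: "op v (time_average s f) x = (?I (v + s) - ?I v) / s" if "0 \<le> v" for v
  proof -
    have "(\<integral>r. op (v + s * r) f x \<partial>unif01) = integral {v..v+s} ?u / s"
    proof (rule integral_unif01_affine(2)[OF _ _ s])
      show "set_borel_measurable borel {v..v+s} ?u"
        using that unfolding set_borel_measurable_def
        by (intro borel_measurable_continuous_on_indicator continuous_on_subset[OF cont]) auto
    qed (use that in \<open>auto intro!: op_bounded[OF f B]\<close>)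
    moreover have "?I v + integral {v..v+s} ?u = ?I (v + s)"
      using that s by (intro Henstock_Kurzweil_Integration.integral_combine int) auto
    ultimately show ?thesis using op_time_average(1)[of s v x] that s by (simp add: field_simps)
  qed
  show ?thesis
    by (rule has_field_derivative_transform_within[OF D zero_less_one]) (simp_all only: eq t atLeast_iff)
qed

lemma op_increment_bounded: "0 \<le> s \<Longrightarrow> 0 \<le> t \<Longrightarrow> \<bar>op (t + s) f x - op t f x\<bar> \<le> 2 * B"
  using op_bounded[OF f B, of "t + s" x] op_bounded[OF f B, of t x] by simp

text \<open>
  Supplies the dominating functions for differentiating integrals over \<open>\<pi>\<close>.
\<close>

lemma op_time_average_lipschitz:
  assumes s: "0 < s" and t: "0 \<le> t" "0 \<le> t'"
  shows "\<bar>op t' (time_average s f) x - op t (time_average s f) x\<bar> \<le> 2 * B / s * \<bar>t' - t\<bar>"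
proof -
  have "norm (op t' (time_average s f) x - op t (time_average s f) x) \<le> 2 * B / s * norm (t' - t)"
  proof (rule field_differentiable_bound[where S="{0..}"])
    fix v :: real assume v: "v \<in> {0..}"
    show "((\<lambda>t. op t (time_average s f) x) has_field_derivative (op (v + s) f x - op v f x) / s) (at v within {0..})"
      using v s by (intro op_time_average_derivative) auto
    show "norm ((op (v + s) f x - op v f x) / s) \<le> 2 * B / s"
      using op_increment_bounded[of s v x] v s by (auto simp: divide_right_mono)
  qed (use t in auto)
  then show ?thesis by simp
qed

lemma bounded_in_L2: "f \<in> L2 \<pi>"
proof -
  have "\<bar>(f x)\<^sup>2\<bar> \<le> B\<^sup>2" for x using power_mono[OF B, of x 2] by simp
  then show ?thesis unfolding L2_def
    using integrable_stationary[of "\<lambda>x. (f x)\<^sup>2" "B\<^sup>2"] measurable_stationary[OF f] by auto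
qed

end

text \<open>
  The difference quotients converge pointwise by \<open>op_time_average_derivative\<close>. The Lipschitz estimate bounds
  them uniformly, so they also converge in \<open>L\<^sup>2(\<pi>)\<close>.
\<close>

lemma generator_time_average:
  assumes f [measurable]: "f \<in> borel_measurable borel" and B: "\<And>x. \<bar>f x\<bar> \<le> B" and s: "0 < s"
  shows "generator P \<pi> (time_average s f) (\<lambda>x. (op s f x - f x) / s)"
  unfolding generator_def
proof (intro conjI)
  let ?F = "time_average s f" and ?h = "\<lambda>x. (op s f x - f x) / s"
  have mF [measurable]: "?F \<in> borel_measurable borel" and bF: "\<And>x. \<bar>?F x\<bar> \<le> B"
    using time_average_measurable[OF f B] time_average_bounded[OF f B] s by auto
  have mh [measurable]: "?h \<in> borel_measurable borel"
    using s by (intro borel_measurable_divide borel_measurable_diff op_measurable f) auto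
  have bh: "\<bar>?h x\<bar> \<le> 2 * B / s" for x
    using op_increment_bounded[OF f B, of s 0 x] s op_zero[OF f] by (simp add: divide_right_mono)
  show "?F \<in> L2 \<pi>" by (rule bounded_in_L2[OF mF bF])
  show "?h \<in> L2 \<pi>" by (rule bounded_in_L2[OF mh bh])
  have "((\<lambda>t. \<integral>x. ((op t ?F x - ?F x) / t - ?h x)\<^sup>2 \<partial>\<pi>) \<longlongrightarrow> (\<integral>x. 0 \<partial>\<pi>)) (at 0 within {0..})"
  proof (rule stat.bounded_convergence_within[where B="(2 * B / s + 2 * B / s)\<^sup>2"])
    fix x
    have "((\<lambda>t. (op t ?F x - ?F x) / t) \<longlongrightarrow> ?h x) (at 0 within {0..})"
      using op_time_average_derivative[OF f B s, of 0 x] op_zero[OF f] op_zero[OF mF]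
      by (simp add: has_field_derivative_iff)
    then have "((\<lambda>t. ((op t ?F x - ?F x) / t - ?h x)\<^sup>2) \<longlongrightarrow> (?h x - ?h x)\<^sup>2) (at 0 within {0..})"
      by (rule tendsto_power[OF tendsto_diff[OF _ tendsto_const]])
    then show "((\<lambda>t. ((op t ?F x - ?F x) / t - ?h x)\<^sup>2) \<longlongrightarrow> 0) (at 0 within {0..})" by simp
  next
    fix t :: real and x assume t: "t \<in> {0..}" "t \<noteq> 0"
    have "\<bar>op t ?F x - ?F x\<bar> \<le> 2 * B / s * t"
      using op_time_average_lipschitz[OF f B s, of 0 t x] t op_zero[OF mF] by simp
    then have "\<bar>(op t ?F x - ?F x) / t\<bar> \<le> 2 * B / s" using t by (simp add: field_simps)
    with bh[of x] have "\<bar>(op t ?F x - ?F x) / t - ?h x\<bar> \<le> 2 * B / s + 2 * B / s" by linarith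
    from power_mono[OF this, of 2]
    show "\<bar>((op t ?F x - ?F x) / t - ?h x)\<^sup>2\<bar> \<le> (2 * B / s + 2 * B / s)\<^sup>2" by simp
  next
    fix t :: real assume "t \<in> {0..}"
    then show "(\<lambda>x. ((op t ?F x - ?F x) / t - ?h x)\<^sup>2) \<in> borel_measurable \<pi>"
      by (intro measurable_stationary) (auto intro: borel_measurable_power)
  qed simp
  then have "((\<lambda>t. sqrt (\<integral>x. ((op t ?F x - ?F x) / t - ?h x)\<^sup>2 \<partial>\<pi>)) \<longlongrightarrow> sqrt 0) (at 0 within {0..})"
    by (intro tendsto_intros) simp
  then show "((\<lambda>t. L2_norm \<pi> (\<lambda>x. (op t ?F x - ?F x) / t - ?h x)) \<longlongrightarrow> 0) (at_right 0)"
    unfolding L2_norm_def by (rule tendsto_within_subset[THEN tendsto_eq_rhs]) auto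
qed

text \<open>
  The infimum in the definition of the gap runs over normalized functions; the general case follows by
  scaling, except that functions vanishing almost everywhere have to be treated apart.
\<close>

lemma spectral_gap_le_dirichlet_form:
  assumes gap: "ereal \<gamma> \<le> spectral_gap P \<pi>" and gen: "generator P \<pi> f h" and mean: "(\<integral>x. f x \<partial>\<pi>) = 0"
  shows "\<gamma> * (\<integral>x. (f x)\<^sup>2 \<partial>\<pi>) \<le> - (\<integral>x. h x * f x \<partial>\<pi>)"
proof (cases "(\<integral>x. (f x)\<^sup>2 \<partial>\<pi>) = 0")
  case True
  have "AE x in \<pi>. (f x)\<^sup>2 = 0"
    using gen True by (subst integral_nonneg_eq_0_iff_AE[symmetric]) (auto simp: generator_def L2_def)
  then have "(\<integral>x. h x * f x \<partial>\<pi>) = (\<integral>x. 0 \<partial>\<pi>)"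
    using gen by (intro integral_cong_AE) (auto simp: generator_def L2_def)
  then show ?thesis using True by simp
next
  case False
  define c where "c = L2_norm \<pi> f"
  have c: "0 < c" and c2: "c\<^sup>2 = (\<integral>x. (f x)\<^sup>2 \<partial>\<pi>)"
    using False by (auto simp: c_def L2_norm_def less_le)
  have scale: "L2_norm \<pi> (\<lambda>x. k x / c) = L2_norm \<pi> k / c" for k
    using c by (simp add: L2_norm_def power_divide real_sqrt_divide)
  have "generator P \<pi> (\<lambda>x. f x / c) (\<lambda>x. h x / c)"
    unfolding generator_def
  proof (intro conjI)
    have "(\<lambda>x. (semigroup_op P t (\<lambda>x. f x / c) x - f x / c) / t - h x / c)
      = (\<lambda>x. ((op t f x - f x) / t - h x) / c)" for t
      by (simp add: semigroup_op_def diff_divide_distrib mult.commute)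
    moreover have "((\<lambda>t. L2_norm \<pi> (\<lambda>x. (op t f x - f x) / t - h x) / c) \<longlongrightarrow> 0 / c) (at_right 0)"
      using gen c by (intro tendsto_intros) (auto simp: generator_def)
    ultimately show "((\<lambda>t. L2_norm \<pi> (\<lambda>x. (semigroup_op P t (\<lambda>x. f x / c) x - f x / c) / t - h x / c)) \<longlongrightarrow> 0) (at_right 0)"
      by (simp add: scale)
  qed (use gen in \<open>auto simp: generator_def L2_def power_divide\<close>)
  moreover have "L2_norm \<pi> (\<lambda>x. f x / c) = 1" using c scale[of f] by (simp add: c_def)
  ultimately have "spectral_gap P \<pi> \<le> ereal (- L2_inner \<pi> (\<lambda>x. h x / c) (\<lambda>x. f x / c))"
    unfolding spectral_gap_def using mean
    by (intro Inf_lower CollectI exI[of _ "\<lambda>x. f x / c"] exI[of _ "\<lambda>x. h x / c"]) auto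
  with gap have "\<gamma> \<le> - (\<integral>x. h x / c * (f x / c) \<partial>\<pi>)"
    using order_trans ereal_less_eq(3) unfolding L2_inner_def by blast
  also have "\<dots> = - (\<integral>x. h x * f x \<partial>\<pi>) / c\<^sup>2" by (simp add: power2_eq_square)
  finally show ?thesis using c by (simp add: c2[symmetric] field_simps)
qed

section \<open>Exponential decay of the variance\<close>

text \<open>
  With \<open>F v = P\<^sub>v (time_average s f)\<close>, which is the time average of \<open>P\<^sub>v f\<close> and hence in the domain of the
  generator with image \<open>H v\<close>, and which has mean zero, the function \<open>\<phi>(v) = \<parallel>F v\<parallel>\<^sup>2\<close> has the derivative
  \<open>2 \<langle>H v, F v\<rangle> \<le> -2 \<gamma> \<phi>(v)\<close>. So \<open>exp(2 \<gamma> v) \<phi>(v)\<close> is nonincreasing.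
\<close>

lemma time_average_decay:
  assumes gap: "ereal \<gamma> \<le> spectral_gap P \<pi>"
    and f: "f \<in> borel_measurable borel" and B: "\<And>x. \<bar>f x\<bar> \<le> B" and mean: "(\<integral>x. f x \<partial>\<pi>) = 0"
    and s: "0 < s" and t: "0 \<le> t"
  shows "(\<integral>x. (op t (time_average s f) x)\<^sup>2 \<partial>\<pi>) \<le> exp (- 2 * \<gamma> * t) * (\<integral>x. (time_average s f x)\<^sup>2 \<partial>\<pi>)"
proof -
  define F where "F = (\<lambda>t. op t (time_average s f))"
  define H where "H = (\<lambda>t x. (op (t + s) f x - op t f x) / s)"
  define \<phi> where "\<phi> = (\<lambda>t. \<integral>x. (F t x)\<^sup>2 \<partial>\<pi>)"
  have mF [measurable]: "F v \<in> borel_measurable borel" and bF: "\<bar>F v x\<bar> \<le> B" if "0 \<le> v" for v x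
    unfolding F_def using that s
    by (auto intro!: op_measurable op_bounded time_average_measurable[OF f B] time_average_bounded[OF f B])
  have mH: "H v \<in> borel_measurable borel" if "0 \<le> v" for v
    unfolding H_def using that s
    by (intro borel_measurable_divide borel_measurable_diff op_measurable f) auto
  have dF: "((\<lambda>v. F v x) has_real_derivative H v x) (at v within {0..})" if "0 \<le> v" for v x
    unfolding F_def H_def by (rule op_time_average_derivative[OF f B s that])
  \<comment> \<open>\<open>undefined\<close> is merely some point of the state space.\<close>
  have B0: "0 \<le> B" using B[of undefined] by simp
  have d\<phi>: "(\<phi> has_real_derivative (\<integral>x. 2 * (H v x * F v x) \<partial>\<pi>)) (at v within {0..})" if v: "0 \<le> v" for v
  proof -
    have lim: "((\<lambda>w. \<integral>x. ((F w x)\<^sup>2 - (F v x)\<^sup>2) / (w - v) \<partial>\<pi>) \<longlongrightarrow> (\<integral>x. 2 * (H v x * F v x) \<partial>\<pi>)) (at v within {0..})"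
    proof (rule stat.bounded_convergence_within[where B="(2 * B / s) * (2 * B)"])
      fix x
      have "((\<lambda>v. (F v x)\<^sup>2) has_real_derivative 2 * (H v x * F v x)) (at v within {0..})"
        by (rule DERIV_power[OF dF[OF v], THEN DERIV_cong]) simp
      then show "((\<lambda>w. ((F w x)\<^sup>2 - (F v x)\<^sup>2) / (w - v)) \<longlongrightarrow> 2 * (H v x * F v x)) (at v within {0..})"
        by (simp add: has_field_derivative_iff)
    next
      fix w :: real and x assume w: "w \<in> {0..}" "w \<noteq> v"
      have "\<bar>F w x - F v x\<bar> \<le> 2 * B / s * \<bar>w - v\<bar>"
        unfolding F_def using op_time_average_lipschitz[OF f B s v] w by simp
      then have 1: "\<bar>F w x - F v x\<bar> / \<bar>w - v\<bar> \<le> 2 * B / s"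
        using w by (simp add: pos_divide_le_eq)
      have 2: "\<bar>F w x + F v x\<bar> \<le> 2 * B" using bF[of w x] bF[of v x] w v by simp
      have "\<bar>((F w x)\<^sup>2 - (F v x)\<^sup>2) / (w - v)\<bar> = \<bar>F w x - F v x\<bar> / \<bar>w - v\<bar> * \<bar>F w x + F v x\<bar>"
        by (simp add: power2_eq_square square_diff_square_factored abs_mult)
      also have "\<dots> \<le> (2 * B / s) * (2 * B)"
        using 1 2 B0 s by (intro mult_mono) auto
      finally show "\<bar>((F w x)\<^sup>2 - (F v x)\<^sup>2) / (w - v)\<bar> \<le> (2 * B / s) * (2 * B)" .
    next
      show "(\<lambda>x. ((F w x)\<^sup>2 - (F v x)\<^sup>2) / (w - v)) \<in> borel_measurable \<pi>" if "w \<in> {0..}" for w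
        using mF[of w] mF[of v] v that by (intro measurable_stationary) auto
      show "(\<lambda>x. 2 * (H v x * F v x)) \<in> borel_measurable \<pi>"
        using mF[of v] mH[of v] v by (intro measurable_stationary) auto
    qed
    have quot: "(\<integral>x. ((F w x)\<^sup>2 - (F v x)\<^sup>2) / (w - v) \<partial>\<pi>) = (\<phi> w - \<phi> v) / (w - v)" if "0 \<le> w" for w
    proof -
      have "integrable \<pi> (\<lambda>x. (F u x)\<^sup>2)" if "0 \<le> u" for u
        using bounded_in_L2[OF mF bF] that by (simp add: L2_def)
      then show ?thesis using that v by (simp add: \<phi>_def)
    qed
    have "eventually (\<lambda>w. (\<integral>x. ((F w x)\<^sup>2 - (F v x)\<^sup>2) / (w - v) \<partial>\<pi>) = (\<phi> w - \<phi> v) / (w - v)) (at v within {0..})"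
      unfolding eventually_at_filter by (intro always_eventually allI impI quot) simp
    from Lim_transform_eventually[OF lim this] show ?thesis unfolding has_field_derivative_iff .
  qed
  have dissipation: "\<gamma> * \<phi> v \<le> - (\<integral>x. H v x * F v x \<partial>\<pi>)" if v: "0 \<le> v" for v
  proof -
    have mv: "op v f \<in> borel_measurable borel" and bv: "\<And>x. \<bar>op v f x\<bar> \<le> B"
      using v by (auto intro!: op_measurable op_bounded f B)
    have "F v = time_average s (op v f)" "H v = (\<lambda>x. (op s (op v f) x - op v f x) / s)"
      using op_time_average(2)[OF f B, of s v] op_semigroup[OF f B, of s v] s v
      by (auto simp: F_def H_def add.commute[of s])
    then have "generator P \<pi> (F v) (H v)"
      using generator_time_average[OF mv bv s] by simp
    moreover have "(\<integral>x. F v x \<partial>\<pi>) = 0"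
      unfolding F_def using v s mean
      by (simp add: stationary_op[OF time_average_measurable[OF f B] time_average_bounded[OF f B]]
          stationary_time_average[OF f B])
    ultimately show ?thesis unfolding \<phi>_def by (rule spectral_gap_le_dirichlet_form[OF gap])
  qed
  let ?\<psi> = "\<lambda>v. exp (2 * \<gamma> * v) * \<phi> v"
  have d\<psi>: "(?\<psi> has_real_derivative 2 * exp (2 * \<gamma> * v) * (\<gamma> * \<phi> v + (\<integral>x. H v x * F v x \<partial>\<pi>))) (at v within {0..})"
    if "0 \<le> v" for v
  proof -
    have "(\<phi> has_real_derivative 2 * (\<integral>x. H v x * F v x \<partial>\<pi>)) (at v within {0..})"
      using d\<phi>[OF that] by simp
    then show ?thesis by (auto intro!: derivative_eq_intros simp: algebra_simps)
  qed
  have "?\<psi> t \<le> ?\<psi> 0"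
  proof (rule DERIV_nonpos_imp_decreasing_open[OF t])
    fix v :: real assume v: "0 < v" "v < t"
    have "at v within {0..} = at v" using v by (intro at_within_interior) simp
    with d\<psi>[of v] dissipation[of v] v
    show "\<exists>y. DERIV ?\<psi> v :> y \<and> y \<le> 0"
      by (intro exI[of _ "2 * exp (2 * \<gamma> * v) * (\<gamma> * \<phi> v + (\<integral>x. H v x * F v x \<partial>\<pi>))"])
        (auto simp: mult_le_0_iff)
  next
    have "continuous_on {0..} ?\<psi>"
      using d\<psi> by (intro DERIV_continuous_on) auto
    then show "continuous_on {0..t} ?\<psi>" by (rule continuous_on_subset) auto
  qed
  then have "\<phi> t \<le> exp (- 2 * \<gamma> * t) * \<phi> 0"
    by (simp add: exp_minus field_simps)
  then show ?thesis
    using op_zero[OF time_average_measurable[OF f B]] s by (simp add: \<phi>_def F_def)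
qed

lemma mean_zero_decay:
  assumes gap: "ereal \<gamma> \<le> spectral_gap P \<pi>"
    and f: "f \<in> borel_measurable borel" and B: "\<And>x. \<bar>f x\<bar> \<le> B" and mean: "(\<integral>x. f x \<partial>\<pi>) = 0"
    and t: "0 \<le> t"
  shows "(\<integral>x. (op t f x)\<^sup>2 \<partial>\<pi>) \<le> exp (- 2 * \<gamma> * t) * (\<integral>x. (f x)\<^sup>2 \<partial>\<pi>)"
proof -
  have lim: "((\<lambda>s. \<integral>x. (time_average s k x)\<^sup>2 \<partial>\<pi>) \<longlongrightarrow> (\<integral>x. (k x)\<^sup>2 \<partial>\<pi>)) (at_right 0)"
    if k: "k \<in> borel_measurable borel" "\<And>x. \<bar>k x\<bar> \<le> B" for k
  proof (rule stat.bounded_convergence_within[where B="B\<^sup>2"])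
    show "((\<lambda>s. (time_average s k x)\<^sup>2) \<longlongrightarrow> (k x)\<^sup>2) (at_right 0)" for x
      by (intro tendsto_power time_average_tendsto[OF k])
    show "\<bar>(time_average s k x)\<^sup>2\<bar> \<le> B\<^sup>2" if "s \<in> {0<..}" for s x
      using power_mono[OF time_average_bounded[OF k, of s x], of 2] that by simp
    show "(\<lambda>x. (time_average s k x)\<^sup>2) \<in> borel_measurable \<pi>" if "s \<in> {0<..}" for s
      using time_average_measurable[OF k, of s] that by (intro measurable_stationary) auto
    show "(\<lambda>x. (k x)\<^sup>2) \<in> borel_measurable \<pi>" using k by (intro measurable_stationary) auto
  qed
  show ?thesis
  proof (rule tendsto_le)
    show "((\<lambda>s. exp (- 2 * \<gamma> * t) * (\<integral>x. (time_average s f x)\<^sup>2 \<partial>\<pi>))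
        \<longlongrightarrow> exp (- 2 * \<gamma> * t) * (\<integral>x. (f x)\<^sup>2 \<partial>\<pi>)) (at_right 0)"
      by (intro tendsto_intros lim f B)
    show "((\<lambda>s. \<integral>x. (time_average s (op t f) x)\<^sup>2 \<partial>\<pi>) \<longlongrightarrow> (\<integral>x. (op t f x)\<^sup>2 \<partial>\<pi>)) (at_right 0)"
      by (intro lim op_measurable op_bounded f B t)
    show "eventually (\<lambda>s. (\<integral>x. (time_average s (op t f) x)\<^sup>2 \<partial>\<pi>)
        \<le> exp (- 2 * \<gamma> * t) * (\<integral>x. (time_average s f x)\<^sup>2 \<partial>\<pi>)) (at_right 0)"
      using time_average_decay[OF gap f B mean _ t] op_time_average(2)[OF f B _ t]
      by (auto simp: eventually_at_filter)
  qed simp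
qed

lemma variance_decay:
  assumes gap: "ereal \<gamma> \<le> spectral_gap P \<pi>"
    and f: "f \<in> borel_measurable borel" and B: "\<And>x. \<bar>f x\<bar> \<le> B" and t: "0 \<le> t"
  shows "(\<integral>x. (op t f x)\<^sup>2 \<partial>\<pi>)
    \<le> (\<integral>x. (f x)\<^sup>2 \<partial>\<pi>) - (1 - exp (- 2 * \<gamma> * t)) * ((\<integral>x. (f x)\<^sup>2 \<partial>\<pi>) - (\<integral>x. f x \<partial>\<pi>)\<^sup>2)"
proof -
  define m where "m = (\<integral>x. f x \<partial>\<pi>)"
  define f0 where "f0 = (\<lambda>x. f x - m)"
  have i: "integrable \<pi> k" "integrable \<pi> (\<lambda>x. (k x)\<^sup>2)"
    if "k \<in> borel_measurable borel" "\<And>x. \<bar>k x\<bar> \<le> B" for k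
    using integrable_stationary[OF that] bounded_in_L2[OF that] by (auto simp: L2_def)
  have sq: "(\<integral>x. (k x - m)\<^sup>2 \<partial>\<pi>) = (\<integral>x. (k x)\<^sup>2 \<partial>\<pi>) - m\<^sup>2"
    if "k \<in> borel_measurable borel" "\<And>x. \<bar>k x\<bar> \<le> B" "(\<integral>x. k x \<partial>\<pi>) = m" for k
    using i[OF that(1,2)] that(3) by (simp add: power2_diff stat.prob_space) (simp add: power2_eq_square)
  have m0: "f0 \<in> borel_measurable borel" and b0: "\<And>x. \<bar>f0 x\<bar> \<le> B + \<bar>m\<bar>"
    using f B by (auto simp: f0_def intro: order_trans[OF abs_triangle_ineq4])
  have "op t f0 x = op t f x - m" for x
  proof -
    interpret p: prob_space "P t x" by (rule kernel_prob[OF t])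
    show ?thesis using integrable_kernel[OF f B t] by (simp add: f0_def semigroup_op_def p.prob_space)
  qed
  then have "(\<integral>x. (op t f x - m)\<^sup>2 \<partial>\<pi>) \<le> exp (- 2 * \<gamma> * t) * (\<integral>x. (f x - m)\<^sup>2 \<partial>\<pi>)"
    using mean_zero_decay[OF gap m0 b0 _ t] i[OF f B] stat.prob_space by (simp add: f0_def m_def)
  moreover have "(\<integral>x. (op t f x - m)\<^sup>2 \<partial>\<pi>) = (\<integral>x. (op t f x)\<^sup>2 \<partial>\<pi>) - m\<^sup>2"
    by (intro sq op_measurable op_bounded f B t) (simp add: stationary_op[OF f B t] m_def)
  moreover have "(\<integral>x. (f x - m)\<^sup>2 \<partial>\<pi>) = (\<integral>x. (f x)\<^sup>2 \<partial>\<pi>) - m\<^sup>2"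
    by (intro sq f B) (simp add: m_def)
  ultimately show ?thesis unfolding m_def by (simp add: algebra_simps)
qed

section \<open>Tilted transition operators\<close>

text \<open>
  One step of length \<open>d\<close> of the discretized Feynman--Kac semigroup with potential \<open>G\<close>.
\<close>

definition tilted_op :: "real \<Rightarrow> ('e \<Rightarrow> real) \<Rightarrow> ('e \<Rightarrow> real) \<Rightarrow> 'e \<Rightarrow> real" where
  "tilted_op d G h = op d (\<lambda>x. exp (d * G x) * h x)"

text \<open>
  Let \<open>k = e\<^sup>d\<^sup>G h\<close>, \<open>A = \<parallel>k\<parallel>\<^sup>2\<close>, \<open>V = A - \<pi>(k)\<^sup>2\<close> and \<open>\<beta> = 1 - exp(-2 \<gamma> d)\<close>. The step loses \<open>\<beta> V\<close> by the decay
  of the variance. The tilting gains, to first order, \<open>2 d \<pi>(G k\<^sup>2) \<le> 2 d R \<surd>A \<surd>V\<close>, which is at most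
  \<open>\<beta> V + d\<^sup>2 R\<^sup>2 A / \<beta>\<close>. The terms \<open>\<beta> V\<close> cancel, which leaves \<open>d\<^sup>2 R\<^sup>2 A / \<beta>\<close>, about
  \<open>d R\<^sup>2 A / (2 \<gamma>)\<close> for small \<open>d\<close>. Finally \<open>A \<le> exp(2 d K) \<parallel>h\<parallel>\<^sup>2\<close>.
\<close>

lemma tilted_op_L2_bound:
  assumes gap: "ereal \<gamma> \<le> spectral_gap P \<pi>" and \<gamma>: "0 < \<gamma>" and d: "0 < d"
    and G: "G \<in> borel_measurable borel" "\<And>x. G x \<in> {l..l + R}" "(\<integral>x. G x \<partial>\<pi>) = 0"
    and K: "\<And>x. \<bar>G x\<bar> \<le> K"
    and h: "h \<in> borel_measurable borel" and B: "\<And>x. \<bar>h x\<bar> \<le> B"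
  shows "(\<integral>x. (tilted_op d G h x)\<^sup>2 \<partial>\<pi>)
    \<le> exp (d\<^sup>2 * R\<^sup>2 / (1 - exp (- 2 * \<gamma> * d)) * exp (2 * d * K)) * (\<integral>x. (h x)\<^sup>2 \<partial>\<pi>)"
proof -
  define \<beta> where "\<beta> = 1 - exp (- 2 * \<gamma> * d)"
  define k where "k = (\<lambda>x. exp (d * G x) * h x)"
  define A where "A = (\<integral>x. (k x)\<^sup>2 \<partial>\<pi>)"
  define N where "N = (\<integral>x. (h x)\<^sup>2 \<partial>\<pi>)"
  define V where "V = A - (\<integral>x. k x \<partial>\<pi>)\<^sup>2"
  define c where "c = d\<^sup>2 * R\<^sup>2 / \<beta>"
  have \<beta>: "0 < \<beta>" using \<gamma> d by (simp add: \<beta>_def)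
  have mk [measurable]: "k \<in> borel_measurable borel" using G(1) h by (simp add: k_def)
  have bk: "\<bar>k x\<bar> \<le> exp (d * K) * B" for x
    unfolding k_def abs_mult using K[of x] B[of x] d
    by (intro mult_mono) (auto simp: abs_le_iff)
  have ih: "integrable \<pi> (\<lambda>x. (h x)\<^sup>2)" and ik: "integrable \<pi> (\<lambda>x. (k x)\<^sup>2)"
    using bounded_in_L2[OF h B] bounded_in_L2[OF mk bk] by (auto simp: L2_def)
  have iG: "integrable \<pi> (\<lambda>x. G x * (k x)\<^sup>2)"
  proof (rule integrable_stationary)
    show "\<bar>G x * (k x)\<^sup>2\<bar> \<le> K * (exp (d * K) * B)\<^sup>2" for x
      using K[of x] power_mono[OF bk[of x], of 2] unfolding abs_mult by (intro mult_mono) auto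
  qed (use G(1) mk in auto)
  note tm = stat.tilted_mean_le[OF measurable_stationary[OF G(1)] measurable_stationary[OF mk] G(2,3) bk]
  have V: "0 \<le> V" using tm(1) by (simp add: V_def A_def)
  have A0: "0 \<le> A" by (simp add: A_def)
  \<comment> \<open>This lower bound for \<open>\<parallel>h\<parallel>\<^sup>2\<close> in terms of \<open>k\<close> has no remainder term, since \<open>exp y \<ge> 1 + y\<close>.\<close>
  have "(k x)\<^sup>2 - 2 * d * (G x * (k x)\<^sup>2) \<le> (h x)\<^sup>2" for x
  proof -
    have "(k x)\<^sup>2 - 2 * d * (G x * (k x)\<^sup>2) = (1 - 2 * d * G x) * (k x)\<^sup>2" by (simp add: algebra_simps)
    also have "(1 - 2 * d * G x) * (k x)\<^sup>2 \<le> exp (- (2 * d * G x)) * (k x)\<^sup>2"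
      using exp_ge_add_one_self[of "- (2 * d * G x)"] by (intro mult_right_mono) auto
    also have "\<dots> = (h x)\<^sup>2"
      by (simp add: k_def power_mult_distrib exp_double[symmetric] mult.assoc[symmetric] exp_add[symmetric])
    finally show ?thesis .
  qed
  then have "(\<integral>x. (k x)\<^sup>2 - 2 * d * (G x * (k x)\<^sup>2) \<partial>\<pi>) \<le> N"
    unfolding N_def using ih ik iG by (intro integral_mono) auto
  moreover have "(\<integral>x. (k x)\<^sup>2 - 2 * d * (G x * (k x)\<^sup>2) \<partial>\<pi>) = A - 2 * d * (\<integral>x. G x * (k x)\<^sup>2 \<partial>\<pi>)"
    using ik iG by (simp add: A_def)
  moreover have "2 * d * (\<integral>x. G x * (k x)\<^sup>2 \<partial>\<pi>) \<le> \<beta> * V + c * A"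
  proof -
    have "2 * d * (\<integral>x. G x * (k x)\<^sup>2 \<partial>\<pi>) \<le> 2 * (d * R * sqrt A) * sqrt V"
      using mult_left_mono[OF tm(2), of "2 * d"] d by (simp add: A_def V_def mult_ac)
    also have "\<dots> \<le> \<beta> * (sqrt V)\<^sup>2 + (d * R * sqrt A)\<^sup>2 / \<beta>" by (rule weighted_AM_GM[OF \<beta>])
    also have "\<dots> = \<beta> * V + c * A" using V A0 by (simp add: c_def power_mult_distrib)
    finally show ?thesis .
  qed
  moreover have "A \<le> exp (2 * d * K) * N"
  proof -
    have "(k x)\<^sup>2 \<le> exp (2 * d * K) * (h x)\<^sup>2" for x
    proof -
      have "(k x)\<^sup>2 = exp (2 * d * G x) * (h x)\<^sup>2"
        by (simp add: k_def power_mult_distrib exp_double[symmetric] mult.assoc)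
      also have "\<dots> \<le> exp (2 * d * K) * (h x)\<^sup>2"
        using K[of x] d by (intro mult_right_mono) (auto simp: abs_le_iff)
      finally show ?thesis .
    qed
    then have "A \<le> (\<integral>x. exp (2 * d * K) * (h x)\<^sup>2 \<partial>\<pi>)"
      unfolding A_def using ih ik by (intro integral_mono) auto
    then show ?thesis by (simp add: N_def)
  qed
  moreover have "(\<integral>x. (tilted_op d G h x)\<^sup>2 \<partial>\<pi>) \<le> A - \<beta> * V"
    using variance_decay[OF gap mk bk, of d] d by (simp add: tilted_op_def k_def[symmetric] A_def V_def \<beta>_def)
  moreover have "0 \<le> c" using \<beta> by (simp add: c_def)
  ultimately have "(\<integral>x. (tilted_op d G h x)\<^sup>2 \<partial>\<pi>) \<le> (1 + c * exp (2 * d * K)) * N"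
    using mult_left_mono[of A "exp (2 * d * K) * N" c] by (simp add: algebra_simps)
  also have "\<dots> \<le> exp (c * exp (2 * d * K)) * N"
    by (intro mult_right_mono exp_ge_add_one_self) (simp add: N_def)
  finally show ?thesis by (simp add: c_def \<beta>_def N_def)
qed

lemma tilted_op_measurable:
  "G \<in> borel_measurable borel \<Longrightarrow> h \<in> borel_measurable borel \<Longrightarrow> 0 \<le> d \<Longrightarrow> tilted_op d G h \<in> borel_measurable borel"
  unfolding tilted_op_def by (intro op_measurable) auto

lemma tilted_op_iterate_regular:
  assumes G: "G \<in> borel_measurable borel" and K: "\<And>x. \<bar>G x\<bar> \<le> K" and d: "0 \<le> d"
  shows "(tilted_op d G ^^ n) (\<lambda>_. 1) \<in> borel_measurable borel"
    and "\<bar>(tilted_op d G ^^ n) (\<lambda>_. 1) x\<bar> \<le> exp (d * K) ^ n"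
proof -
  let ?h = "\<lambda>n. (tilted_op d G ^^ n) (\<lambda>_. 1)"
  have "?h n \<in> borel_measurable borel \<and> (\<forall>x. \<bar>?h n x\<bar> \<le> exp (d * K) ^ n)"
  proof (induction n)
    case (Suc n)
    then have m: "?h n \<in> borel_measurable borel" and b: "\<And>x. \<bar>?h n x\<bar> \<le> exp (d * K) ^ n" by auto
    have "\<bar>exp (d * G y) * ?h n y\<bar> \<le> exp (d * K) * exp (d * K) ^ n" for y
      unfolding abs_mult using K[of y] b[of y] d
      by (intro mult_mono) (auto simp: abs_le_iff mult_left_mono)
    then have "\<bar>tilted_op d G (?h n) x\<bar> \<le> exp (d * K) * exp (d * K) ^ n" for x
      unfolding tilted_op_def[of d G "?h n"] using m G d by (intro op_bounded) auto
    then show ?case using tilted_op_measurable[OF G m d] by simp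
  qed auto
  then show "?h n \<in> borel_measurable borel" "\<bar>?h n x\<bar> \<le> exp (d * K) ^ n" by auto
qed

lemma tilted_op_iterate_mean:
  assumes gap: "ereal \<gamma> \<le> spectral_gap P \<pi>" and \<gamma>: "0 < \<gamma>" and d: "0 < d"
    and G: "G \<in> borel_measurable borel" "\<And>x. G x \<in> {l..l + R}" "(\<integral>x. G x \<partial>\<pi>) = 0"
    and K: "\<And>x. \<bar>G x\<bar> \<le> K"
  shows "(\<integral>x. (tilted_op d G ^^ n) (\<lambda>_. 1) x \<partial>\<pi>)
    \<le> exp (real n * (d\<^sup>2 * R\<^sup>2 / (1 - exp (- 2 * \<gamma> * d)) * exp (2 * d * K)) / 2)"
proof -
  define c where "c = d\<^sup>2 * R\<^sup>2 / (1 - exp (- 2 * \<gamma> * d)) * exp (2 * d * K)"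
  let ?h = "\<lambda>n. (tilted_op d G ^^ n) (\<lambda>_. 1)"
  note reg = tilted_op_iterate_regular[OF G(1) K less_imp_le[OF d]]
  have L2: "(\<integral>x. (?h n x)\<^sup>2 \<partial>\<pi>) \<le> exp (real n * c)" for n
  proof (induction n)
    case (Suc n)
    have "(\<integral>x. (?h (Suc n) x)\<^sup>2 \<partial>\<pi>) \<le> exp c * (\<integral>x. (?h n x)\<^sup>2 \<partial>\<pi>)"
      using tilted_op_L2_bound[OF gap \<gamma> d G K reg] by (simp add: c_def)
    also have "\<dots> \<le> exp c * exp (real n * c)" using Suc by simp
    finally show ?case by (simp add: exp_add[symmetric] algebra_simps)
  qed simp
  have "(\<integral>x. ?h n x \<partial>\<pi>)\<^sup>2 \<le> (\<integral>x. (?h n x)\<^sup>2 \<partial>\<pi>)"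
    by (rule stat.tilted_mean_le(1)[OF measurable_stationary[OF G(1)] measurable_stationary[OF reg(1)] G(2,3) reg(2)])
  also have "\<dots> \<le> (exp (real n * c / 2))\<^sup>2"
    using L2[of n] by (simp add: exp_double[symmetric])
  finally show ?thesis unfolding c_def by (rule power2_le_imp_le) simp
qed

end

section \<open>From the semigroup to the process\<close>

locale stationary_jump_process = stationary_jump_semigroup P \<pi>
  for P :: "real \<Rightarrow> 'e::topological_space \<Rightarrow> 'e measure" and \<pi> +
  fixes M :: "'w measure" and X :: "real \<Rightarrow> 'w \<Rightarrow> 'e"
  assumes process: "markov_process M X P \<pi>"
begin

sublocale prob_space M
  using process by (simp add: markov_process_def)

lemma X_jointly_measurable:
  assumes [measurable]: "\<tau> \<in> borel_measurable N" and "\<And>z. z \<in> space N \<Longrightarrow> 0 \<le> \<tau> z"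
  shows "(\<lambda>(z, \<omega>). X (\<tau> z) \<omega>) \<in> N \<Otimes>\<^sub>M M \<rightarrow>\<^sub>M borel"
proof -
  have X: "(\<lambda>(s, \<omega>). X s \<omega>) \<in> restrict_space borel {0..} \<Otimes>\<^sub>M M \<rightarrow>\<^sub>M borel"
    using process by (simp add: markov_process_def)
  have "\<tau> \<in> N \<rightarrow>\<^sub>M restrict_space borel {0..}"
    using assms by (intro measurable_restrict_space2) auto
  then have "(\<lambda>z. (\<tau> (fst z), snd z)) \<in> N \<Otimes>\<^sub>M M \<rightarrow>\<^sub>M restrict_space borel {0..} \<Otimes>\<^sub>M M"
    by (intro measurable_Pair measurable_compose[OF measurable_fst] measurable_snd)
  from measurable_compose[OF this X] show ?thesis by (simp add: split_def)
qed

lemma X_measurable: "0 \<le> s \<Longrightarrow> X s \<in> M \<rightarrow>\<^sub>M borel"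
  using measurable_Pair2[OF X_jointly_measurable[of "\<lambda>s. s" "restrict_space borel {0..}"], of s]
  by (simp add: space_restrict_space measurable_restrict_space1)

lemma X_path_measurable:
  "\<omega> \<in> space M \<Longrightarrow> (\<lambda>s. X s \<omega>) \<in> restrict_space borel {0..} \<rightarrow>\<^sub>M borel"
  using measurable_Pair1[OF X_jointly_measurable[of "\<lambda>s. s" "restrict_space borel {0..}"], of \<omega>]
  by (simp add: space_restrict_space measurable_restrict_space1)

lemma natural_filtration_generators: "{X u -` A \<inter> space M | u A. 0 \<le> u \<and> u \<le> s \<and> A \<in> sets borel} \<subseteq> Pow (space M)"
  by auto

lemma space_natural_filtration [simp]: "space (natural_filtration M X s) = space M"
  unfolding natural_filtration_def by (rule space_measure_of[OF natural_filtration_generators])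

lemma sets_natural_filtration: "sets (natural_filtration M X s) =
   sigma_sets (space M) {X u -` A \<inter> space M | u A. 0 \<le> u \<and> u \<le> s \<and> A \<in> sets borel}"
  unfolding natural_filtration_def by (rule sets_measure_of[OF natural_filtration_generators])

lemma X_adapted: "0 \<le> u \<Longrightarrow> u \<le> s \<Longrightarrow> X u \<in> natural_filtration M X s \<rightarrow>\<^sub>M borel"
  by (rule measurableI) (auto simp: sets_natural_filtration intro!: sigma_sets.Basic)

lemma natural_filtration_subalgebra: "subalgebra M (natural_filtration M X s)"
  unfolding subalgebra_def
  using X_measurable by (auto simp: sets_natural_filtration intro!: sets.sigma_sets_subset' measurable_sets elim!: sets.sigma_sets_subset[THEN subsetD, rotated])

text \<open>
  The defining property of the process concerns indicator functions. It says that two finite measures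
  agree: the distribution of the later state under the weight \<open>Z\<close>, and the weighted distribution of
  the present state followed by one transition. Hence their integrals agree for all bounded \<open>f\<close>.
\<close>

lemma markov_property:
  assumes s: "0 \<le> s" and t: "0 \<le> t"
    and Z: "Z \<in> borel_measurable (natural_filtration M X s)" "\<And>\<omega>. \<omega> \<in> space M \<Longrightarrow> 0 \<le> Z \<omega>" "\<And>\<omega>. \<omega> \<in> space M \<Longrightarrow> Z \<omega> \<le> C"
    and f: "f \<in> borel_measurable borel" and B: "\<And>x. \<bar>f x\<bar> \<le> B"
  shows "(\<integral>\<omega>. Z \<omega> * f (X (s + t) \<omega>) \<partial>M) = (\<integral>\<omega>. Z \<omega> * op t f (X s \<omega>) \<partial>M)"
proof -
  let ?F = "natural_filtration M X s"
  interpret finite_measure_subalgebra M ?F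
    by unfold_locales (rule natural_filtration_subalgebra)
  have mZ [measurable]: "Z \<in> borel_measurable M"
    by (rule measurable_from_subalg[OF natural_filtration_subalgebra Z(1)])
  have mX [measurable]: "X s \<in> M \<rightarrow>\<^sub>M borel" "X (s + t) \<in> M \<rightarrow>\<^sub>M borel"
    using s t by (auto intro!: X_measurable)
  note mP = kernel[OF t]
  define D where "D = density M (\<lambda>\<omega>. ennreal (Z \<omega>))"
  have int_D: "(\<integral>\<omega>. k \<omega> \<partial>D) = (\<integral>\<omega>. Z \<omega> * k \<omega> \<partial>M)" if "k \<in> borel_measurable M" for k :: "'w \<Rightarrow> real"
    unfolding D_def using that Z(2) by (subst integral_density) auto
  have iZ: "integrable M (\<lambda>\<omega>. Z \<omega> * k \<omega>)" if "k \<in> borel_measurable M" "\<And>\<omega>. k \<omega> \<in> {0..1}" for k :: "'w \<Rightarrow> real"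
  proof (rule bounded_integrable)
    show "\<bar>Z \<omega> * k \<omega>\<bar> \<le> C * 1" if "\<omega> \<in> space M" for \<omega>
      unfolding abs_mult using Z(2,3)[OF that] \<open>\<And>\<omega>. k \<omega> \<in> {0..1}\<close>[of \<omega>] by (intro mult_mono) auto
  qed (use that in measurable)
  have nn_D: "(\<integral>\<^sup>+\<omega>. ennreal (k \<omega>) \<partial>D) = ennreal (\<integral>\<omega>. Z \<omega> * k \<omega> \<partial>M)"
    if "k \<in> borel_measurable M" "\<And>\<omega>. k \<omega> \<in> {0..1}" for k :: "'w \<Rightarrow> real"
  proof -
    have "(\<integral>\<^sup>+\<omega>. ennreal (k \<omega>) \<partial>D) = (\<integral>\<^sup>+\<omega>. ennreal (Z \<omega> * k \<omega>) \<partial>M)"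
      unfolding D_def using that(1) Z(2) by (subst nn_integral_density) (auto simp: ennreal_mult' intro!: nn_integral_cong)
    also have "\<dots> = ennreal (\<integral>\<omega>. Z \<omega> * k \<omega> \<partial>M)"
      using Z(2) that by (intro nn_integral_eq_integral iZ) (auto intro!: AE_I2)
    finally show ?thesis .
  qed
  have fin_D: "finite_measure D"
    using nn_D[of "\<lambda>_. 1"] by (intro finite_measureI) (simp add: D_def)
  have mXD [measurable]: "X s \<in> D \<rightarrow>\<^sub>M borel" "X (s + t) \<in> D \<rightarrow>\<^sub>M borel" by (simp_all add: D_def)
  have "distr D borel (X (s + t)) = distr D borel (X s) \<bind> P t"
  proof (rule measure_eqI)
    show "sets (distr D borel (X (s + t))) = sets (distr D borel (X s) \<bind> P t)"
      by (subst sets_bind[where N=borel]) (auto simp: sets_kernel[OF t])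
    fix A assume "A \<in> sets (distr D borel (X (s + t)))"
    then have A [measurable]: "A \<in> sets borel" by simp
    have mA: "(\<lambda>x. measure (P t x) A) \<in> borel_measurable borel"
      using measurable_compose[OF mP measurable_measure_subprob_algebra[OF A]] by simp
    have pA: "measure (P t x) A \<in> {0..1}" for x
      using prob_space.prob_le_1[OF kernel_prob[OF t]] by simp
    have "emeasure (distr D borel (X (s + t))) A = (\<integral>\<^sup>+\<omega>. ennreal (indicator A (X (s + t) \<omega>)) \<partial>D)"
      by (subst nn_integral_indicator[symmetric], simp, subst nn_integral_distr)
         (auto intro!: nn_integral_cong simp: indicator_def)
    also have "\<dots> = ennreal (\<integral>\<omega>. Z \<omega> * indicator A (X (s + t) \<omega>) \<partial>M)"
      by (rule nn_D) (auto simp: indicator_def)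
    also have "(\<integral>\<omega>. Z \<omega> * indicator A (X (s + t) \<omega>) \<partial>M)
      = (\<integral>\<omega>. Z \<omega> * real_cond_exp M ?F (\<lambda>\<omega>. indicator A (X (s + t) \<omega>)) \<omega> \<partial>M)"
      by (rule real_cond_exp_intg(2)[symmetric, OF iZ Z(1)]) (auto simp: indicator_def)
    also have "\<dots> = (\<integral>\<omega>. Z \<omega> * measure (P t (X s \<omega>)) A \<partial>M)"
    proof (rule integral_cong_AE)
      show "AE \<omega> in M. Z \<omega> * real_cond_exp M ?F (\<lambda>\<omega>. indicator A (X (s + t) \<omega>)) \<omega> = Z \<omega> * measure (P t (X s \<omega>)) A"
        using process s t A unfolding markov_process_def by fastforce
    qed (use measurable_compose[OF mX(1) mA] in auto)
    also have "ennreal \<dots> = (\<integral>\<^sup>+\<omega>. ennreal (measure (P t (X s \<omega>)) A) \<partial>D)"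
      using measurable_compose[OF mX(1) mA] pA by (intro nn_D[symmetric]) auto
    also have "\<dots> = (\<integral>\<^sup>+\<omega>. emeasure (P t (X s \<omega>)) A \<partial>D)"
      using finite_measure.emeasure_eq_measure[OF prob_space.finite_measure[OF kernel_prob[OF t]]] by simp
    also have "\<dots> = (\<integral>\<^sup>+x. emeasure (P t x) A \<partial>distr D borel (X s))"
      using measurable_compose[OF mP measurable_emeasure_subprob_algebra[OF A]] by (intro nn_integral_distr[symmetric]) auto
    also have "\<dots> = emeasure (distr D borel (X s) \<bind> P t) A"
      using mP by (intro emeasure_bind[symmetric, where N=borel]) auto
    finally show "emeasure (distr D borel (X (s + t))) A = emeasure (distr D borel (X s) \<bind> P t) A" .
  qed
  then have "(\<integral>x. f x \<partial>distr D borel (X (s + t))) = (\<integral>x. f x \<partial>(distr D borel (X s) \<bind> P t))" by simp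
  also have "\<dots> = (\<integral>x. (\<integral>y. f y \<partial>P t x) \<partial>distr D borel (X s))"
  proof (rule integral_bind[where K=borel and B'=1 and B=B])
    show "finite_measure (distr D borel (X s))"
      by (rule finite_measure.finite_measure_distr[OF fin_D]) simp
    show "AE y in distr D borel (X s). emeasure (P t y) (space (P t y)) \<le> ennreal 1"
      using prob_space.emeasure_space_1[OF kernel_prob[OF t]] by simp
  qed (use f B mP in auto)
  finally show ?thesis
    using f op_measurable[OF f t] by (simp add: integral_distr int_D semigroup_op_def[abs_def])
qed

lemma marginal:
  fixes f :: "'e \<Rightarrow> real"
  assumes s: "0 \<le> s" and f: "f \<in> borel_measurable borel" and B: "\<And>x. \<bar>f x\<bar> \<le> B"
  shows "(\<integral>\<omega>. f (X s \<omega>) \<partial>M) = (\<integral>x. f x \<partial>\<pi>)"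
proof -
  have d0: "distr M borel (X 0) = \<pi>" using process by (simp add: markov_process_def)
  have "(\<integral>\<omega>. f (X s \<omega>) \<partial>M) = (\<integral>\<omega>. op s f (X 0 \<omega>) \<partial>M)"
    using markov_property[of 0 s "\<lambda>_. 1" 1, OF _ s _ _ _ f B] by simp
  also have "\<dots> = (\<integral>x. op s f x \<partial>\<pi>)"
    unfolding d0[symmetric] using s by (intro integral_distr[symmetric] op_measurable f X_measurable) auto
  also have "\<dots> = (\<integral>x. f x \<partial>\<pi>)" by (rule stationary_op[OF f B s])
  finally show ?thesis .
qed

text \<open>
  Conditioning from the last time backwards replaces one factor after another by the tilted operator.
  The induction keeps a last factor without transition, so the operator occurs \<open>n - 1\<close> times first;
  invariance of \<open>\<pi>\<close> inserts the missing transition at the end.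
\<close>

lemma expectation_exp_sum:
  assumes u: "0 \<le> u" and d: "0 \<le> d" and G: "G \<in> borel_measurable borel" and K: "\<And>x. \<bar>G x\<bar> \<le> K"
  shows "(\<integral>\<omega>. exp (\<Sum>k<n. d * G (X (u + real k * d) \<omega>)) \<partial>M) = (\<integral>x. (tilted_op d G ^^ n) (\<lambda>_. 1) x \<partial>\<pi>)"
proof -
  let ?W = "\<lambda>m \<omega>. exp (\<Sum>k<m. d * G (X (u + real k * d) \<omega>))"
  have pos: "0 \<le> u + real k * d" for k using u d by simp
  have main: "(\<integral>\<omega>. ?W m \<omega> * (exp (d * G (X (u + real m * d) \<omega>)) * f (X (u + real m * d) \<omega>)) \<partial>M)
      = (\<integral>x. exp (d * G x) * (tilted_op d G ^^ m) f x \<partial>\<pi>)"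
    if f: "f \<in> borel_measurable borel" and B: "\<And>x. \<bar>f x\<bar> \<le> B" for m f B
    using f B
  proof (induction m arbitrary: f B)
    case 0
    have "\<bar>exp (d * G x) * f x\<bar> \<le> exp (d * K) * B" for x
      unfolding abs_mult using K[of x] 0(2)[of x] d by (intro mult_mono) (auto simp: abs_le_iff mult_left_mono)
    from marginal[OF u _ this] G 0(1)
    have "(\<integral>\<omega>. exp (d * G (X u \<omega>)) * f (X u \<omega>) \<partial>M) = (\<integral>x. exp (d * G x) * f x \<partial>\<pi>)" by measurable
    then show ?case by simp
  next
    case (Suc m)
    let ?k = "\<lambda>x. exp (d * G x) * f x"
    have mk: "?k \<in> borel_measurable borel" using G Suc(2) by simp
    have bk: "\<bar>?k x\<bar> \<le> exp (d * K) * B" for x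
      unfolding abs_mult using K[of x] Suc(3)[of x] d by (intro mult_mono) (auto simp: abs_le_iff mult_left_mono)
    have mT: "tilted_op d G f \<in> borel_measurable borel" by (rule tilted_op_measurable[OF G Suc(2) d])
    have bT: "\<bar>tilted_op d G f x\<bar> \<le> exp (d * K) * B" for x
      unfolding tilted_op_def by (rule op_bounded[OF mk bk d])
    have time: "u + real (Suc m) * d = (u + real m * d) + d" by (simp add: algebra_simps)
    have "(\<integral>\<omega>. ?W (Suc m) \<omega> * ?k (X (u + real (Suc m) * d) \<omega>) \<partial>M)
      = (\<integral>\<omega>. ?W (Suc m) \<omega> * op d ?k (X (u + real m * d) \<omega>) \<partial>M)"
      unfolding time
    proof (rule markov_property[OF pos d _ _ _ mk bk])
      have "X (u + real k * d) \<in> natural_filtration M X (u + real m * d) \<rightarrow>\<^sub>M borel" if "k < Suc m" for k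
        using that d by (intro X_adapted pos) (auto intro!: mult_right_mono)
      then show "?W (Suc m) \<in> borel_measurable (natural_filtration M X (u + real m * d))"
        by (intro measurable_compose[OF _ borel_measurable_exp] borel_measurable_sum borel_measurable_times borel_measurable_const
            measurable_compose[OF _ G]) auto
      have "(\<Sum>k<Suc m. d * G (X (u + real k * d) \<omega>)) \<le> (\<Sum>k<Suc m. d * K)" for \<omega>
        using K d by (intro sum_mono mult_left_mono) (auto simp: abs_le_iff)
      then show "?W (Suc m) \<omega> \<le> exp (\<Sum>k<Suc m. d * K)" for \<omega> by (simp only: exp_le_cancel_iff)
    qed simp
    also have "\<dots> = (\<integral>\<omega>. ?W m \<omega> * (exp (d * G (X (u + real m * d) \<omega>)) * tilted_op d G f (X (u + real m * d) \<omega>)) \<partial>M)"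
      by (simp add: tilted_op_def exp_add mult_ac)
    also have "\<dots> = (\<integral>x. exp (d * G x) * (tilted_op d G ^^ m) (tilted_op d G f) x \<partial>\<pi>)"
      by (rule Suc.IH[OF mT bT])
    finally show ?case by (simp add: funpow_swap1)
  qed
  show ?thesis
  proof (cases n)
    case 0
    then show ?thesis using prob_space by simp
  next
    case (Suc m)
    let ?h = "(tilted_op d G ^^ m) (\<lambda>_. 1)"
    note reg = tilted_op_iterate_regular[OF G K d]
    have "\<bar>exp (d * G x) * ?h x\<bar> \<le> exp (d * K) * exp (d * K) ^ m" for x
      unfolding abs_mult using K[of x] reg(2)[of m x] d by (intro mult_mono) (auto simp: abs_le_iff mult_left_mono)
    then have "(\<integral>x. op d (\<lambda>x. exp (d * G x) * ?h x) x \<partial>\<pi>) = (\<integral>x. exp (d * G x) * ?h x \<partial>\<pi>)"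
      using G reg(1) by (intro stationary_op[OF _ _ d]) auto
    with main[of "\<lambda>_. 1" 1 m] Suc show ?thesis
      by (simp add: tilted_op_def exp_add)
  qed
qed

text \<open>
  The grid \<open>d r, d r + d, d r + 2d, ...\<close> is shifted by a uniform fraction \<open>r\<close> of the step. The mean over
  \<open>r\<close> of the Riemann sums is the time integral itself, so Jensen's inequality and Fubini's theorem
  reduce the claim to fixed grids.
\<close>

lemma exponential_moment_discretized:
  assumes gap: "ereal \<gamma> \<le> spectral_gap P \<pi>" and \<gamma>: "0 < \<gamma>" and d: "0 < d"
    and G: "G \<in> borel_measurable borel" "\<And>x. G x \<in> {l..l + R}" "(\<integral>x. G x \<partial>\<pi>) = 0"
    and K: "\<And>x. \<bar>G x\<bar> \<le> K"
  shows "(\<integral>\<omega>. exp (LBINT s:{0..real n * d}. G (X s \<omega>)) \<partial>M)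
    \<le> exp (real n * (d\<^sup>2 * R\<^sup>2 / (1 - exp (- 2 * \<gamma> * d)) * exp (2 * d * K)) / 2)" (is "_ \<le> ?bound")
proof -
  have K0: "0 \<le> K" using K[of undefined] by simp
  let ?S = "\<lambda>r \<omega>. \<Sum>k<n. d * G (X (d * r + real k * d) \<omega>)"
  have m1: "(\<lambda>(r, \<omega>). G (X (d * r + real k * d) \<omega>)) \<in> borel_measurable (unif01 \<Otimes>\<^sub>M M)" for k
  proof -
    have "(\<lambda>(r, \<omega>). X (real k * d + d * r) \<omega>) \<in> unif01 \<Otimes>\<^sub>M M \<rightarrow>\<^sub>M borel"
      using d by (intro X_jointly_measurable) auto
    from measurable_compose[OF this G(1)] show ?thesis by (simp add: split_def add.commute)
  qed
  then have mS: "(\<lambda>(r, \<omega>). ?S r \<omega>) \<in> borel_measurable (unif01 \<Otimes>\<^sub>M M)"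
    unfolding split_def by (intro borel_measurable_sum borel_measurable_times) auto
  have bS: "\<bar>?S r \<omega>\<bar> \<le> real n * (d * K)" for r \<omega>
  proof -
    have "\<bar>?S r \<omega>\<bar> \<le> (\<Sum>k<n. \<bar>d * G (X (d * r + real k * d) \<omega>)\<bar>)" by (rule sum_abs)
    also have "\<dots> \<le> (\<Sum>k<n. d * K)" using K d by (intro sum_mono) (auto simp: abs_mult)
    finally show ?thesis by simp
  qed
  have bE: "\<bar>exp (?S r \<omega>)\<bar> \<le> exp (real n * (d * K))" for r \<omega> using bS[of r \<omega>] by simp
  interpret U: pair_prob_space unif01 M ..
  have path: "(LBINT s:{0..real n * d}. G (X s \<omega>)) = (\<integral>r. ?S r \<omega> \<partial>unif01)" if \<omega>: "\<omega> \<in> space M" for \<omega>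
  proof -
    let ?Y = "\<lambda>s. G (X s \<omega>)"
    have mY: "set_borel_measurable borel {v..w} ?Y" if "0 \<le> v" for v w
    proof -
      have "?Y \<in> borel_measurable (restrict_space borel {0..})"
        by (rule measurable_compose[OF X_path_measurable[OF \<omega>] G(1)])
      then have "set_borel_measurable borel {0..} ?Y"
        by (simp add: set_borel_measurable_def borel_measurable_restrict_space_iff)
      then show ?thesis by (rule set_borel_measurable_subset) (use that in auto)
    qed
    have iY: "set_integrable lborel {v..w} ?Y" if "0 \<le> v" "v < w" for v w
      using integral_unif01_affine(1)[of v "w - v" ?Y K] mY[of v w] K that by auto
    have eq: "integral {real k * d..real k * d + d} ?Y = d * (\<integral>r. G (X (d * r + real k * d) \<omega>) \<partial>unif01)" for k
      using integral_unif01_affine(2)[of "real k * d" d ?Y K] mY[of "real k * d"] K d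
      by (simp add: add.commute)
    have sum: "integral {0..real m * d} ?Y = (\<Sum>k<m. integral {real k * d..real k * d + d} ?Y)" for m
    proof (induction m)
      case (Suc m)
      have "?Y integrable_on {0..real m * d + d}"
        using iY[of 0 "real m * d + d"] d by (intro set_borel_integral_eq_integral(1)) (auto simp: add_nonneg_pos)
      then have "integral {0..real m * d} ?Y + integral {real m * d..real m * d + d} ?Y = integral {0..real m * d + d} ?Y"
        using d by (intro Henstock_Kurzweil_Integration.integral_combine) auto
      then show ?case using Suc by (simp add: distrib_right add.commute)
    qed simp
    have int: "integrable unif01 (\<lambda>r. d * G (X (d * r + real k * d) \<omega>))" for k
      using measurable_Pair1[OF m1 \<omega>, of k] K
      by (intro integrable_mult_right unif01.bounded_integrable[where B=K]) auto
    have "(LBINT s:{0..real n * d}. ?Y s) = integral {0..real n * d} ?Y"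
    proof (cases n)
      case 0
      \<comment> \<open>For \<open>n = 0\<close> the interval is a single point, and both sides vanish.\<close>
    have "AE s in lborel. indicator {0..0::real} s *\<^sub>R ?Y s = 0"
        using AE_lborel_singleton[of 0] by eventually_elim (auto simp: indicator_def)
      then show ?thesis unfolding set_lebesgue_integral_def using 0 by (simp add: integral_eq_zero_AE)
    next
      case (Suc m)
      then show ?thesis using iY[of 0 "real n * d"] d by (intro set_borel_integral_eq_integral(2)) auto
    qed
    also have "\<dots> = (\<Sum>k<n. \<integral>r. d * G (X (d * r + real k * d) \<omega>) \<partial>unif01)"
      unfolding sum eq by simp
    also have "\<dots> = (\<integral>r. ?S r \<omega> \<partial>unif01)" using int by (intro Bochner_Integration.integral_sum[symmetric]) auto
    finally show ?thesis .
  qed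
  have mE: "(\<lambda>(r, \<omega>). exp (?S r \<omega>)) \<in> borel_measurable (unif01 \<Otimes>\<^sub>M M)"
    using measurable_compose[OF mS borel_measurable_exp] by (simp add: split_def)
  have iE: "integrable (unif01 \<Otimes>\<^sub>M M) (\<lambda>(r, \<omega>). exp (?S r \<omega>))"
    using bE by (intro U.P.bounded_integrable[OF mE, where B="exp (real n * (d * K))"]) (simp add: split_def)
  have jensen: "exp (\<integral>r. ?S r \<omega> \<partial>unif01) \<le> (\<integral>r. exp (?S r \<omega>) \<partial>unif01)" if \<omega>: "\<omega> \<in> space M" for \<omega>
  proof (rule unif01.jensens_inequality[where I=UNIV])
    show "integrable unif01 (\<lambda>r. ?S r \<omega>)"
      using measurable_Pair1[OF mS \<omega>] bS by (intro unif01.bounded_integrable[where B="real n * (d * K)"]) auto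
    show "integrable unif01 (\<lambda>r. exp (?S r \<omega>))"
      using measurable_Pair1[OF mE \<omega>] bE by (intro unif01.bounded_integrable[where B="exp (real n * (d * K))"]) auto
  qed (auto intro: exp_convex)
  have "(\<integral>\<omega>. exp (LBINT s:{0..real n * d}. G (X s \<omega>)) \<partial>M) \<le> (\<integral>\<omega>. (\<integral>r. exp (?S r \<omega>) \<partial>unif01) \<partial>M)"
  proof (rule integral_mono_AE')
    show "integrable M (\<lambda>\<omega>. \<integral>r. exp (?S r \<omega>) \<partial>unif01)" by (rule U.integrable_snd[OF iE])
  qed (use path jensen in \<open>auto intro!: AE_I2\<close>)
  also have "\<dots> = (\<integral>r. (\<integral>\<omega>. exp (?S r \<omega>) \<partial>M) \<partial>unif01)" by (rule U.Fubini_integral[OF iE])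
  also have "\<dots> \<le> (\<integral>r. ?bound \<partial>unif01)"
  proof (rule integral_mono)
    show "integrable unif01 (\<lambda>r. \<integral>\<omega>. exp (?S r \<omega>) \<partial>M)" by (rule U.integrable_fst[OF iE])
    show "(\<integral>\<omega>. exp (?S r \<omega>) \<partial>M) \<le> ?bound" if "r \<in> space unif01" for r
      using tilted_op_iterate_mean[OF gap \<gamma> d G K, of n] expectation_exp_sum[of "d * r" d G K n] that d G(1) K
      by auto
  qed simp
  also have "\<dots> = ?bound" using unif01.prob_space by simp
  finally show ?thesis .
qed

text \<open>
  Since \<open>n d = t\<close> and \<open>d / (1 - exp(-2 \<gamma> d)) \<rightarrow> 1 / (2 \<gamma>)\<close> as \<open>d \<rightarrow> 0\<close>, this is the limit \<open>n \<rightarrow> \<infinity>\<close> of the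
  discretized bound.
\<close>

lemma exponential_moment:
  assumes gap: "ereal \<gamma> \<le> spectral_gap P \<pi>" and \<gamma>: "0 < \<gamma>" and t: "0 < t"
    and G: "G \<in> borel_measurable borel" "\<And>x. G x \<in> {l..l + R}" "(\<integral>x. G x \<partial>\<pi>) = 0"
  shows "(\<integral>\<omega>. exp (LBINT s:{0..t}. G (X s \<omega>)) \<partial>M) \<le> exp (t * R\<^sup>2 / (4 * \<gamma>))"
proof (rule tendsto_lowerbound)
  let ?K = "\<bar>l\<bar> + \<bar>R\<bar>"
  let ?b = "\<lambda>n. exp (real n * ((t / real n)\<^sup>2 * R\<^sup>2 / (1 - exp (- 2 * \<gamma> * (t / real n))) * exp (2 * (t / real n) * ?K)) / 2)"
  have K: "\<bar>G x\<bar> \<le> ?K" for x using G(2)[of x] by auto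
  have "(\<integral>\<omega>. exp (LBINT s:{0..t}. G (X s \<omega>)) \<partial>M) \<le> ?b n" if "0 < n" for n
    using exponential_moment_discretized[OF gap \<gamma> _ G K, of "t / real n" n] that t by simp
  then show "eventually (\<lambda>n. (\<integral>\<omega>. exp (LBINT s:{0..t}. G (X s \<omega>)) \<partial>M) \<le> ?b n) sequentially"
    by (rule eventually_mono[OF eventually_gt_at_top[of 0]])
  have "(\<lambda>n. real n * ((t / real n)\<^sup>2 * R\<^sup>2 / (1 - exp (- 2 * \<gamma> * (t / real n))) * exp (2 * (t / real n) * ?K)) / 2)
      \<longlonglongrightarrow> t * R\<^sup>2 / (4 * \<gamma>)"
  proof -
    define L where "L = R\<^sup>2"
    define K' where "K' = ?K"
    have "(\<lambda>n. real n * ((t / real n)\<^sup>2 * 1 / (1 - exp (- 2 * \<gamma> * (t / real n))) * exp (2 * (t / real n) * K')) / 2)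
      \<longlonglongrightarrow> t\<^sup>2 * (inverse \<gamma> * inverse t) / 4"
      using \<gamma> t by real_asymp
    also have "t\<^sup>2 * (inverse \<gamma> * inverse t) / 4 = t / (4 * \<gamma>)"
      using \<gamma> t by (simp add: power2_eq_square field_simps)
    finally have "(\<lambda>n. real n * ((t / real n)\<^sup>2 * 1 / (1 - exp (- 2 * \<gamma> * (t / real n))) * exp (2 * (t / real n) * K')) / 2)
      \<longlonglongrightarrow> t / (4 * \<gamma>)" .
    from tendsto_mult_left[OF this, of L] show ?thesis by (simp add: L_def K'_def mult_ac)
  qed
  then show "?b \<longlonglongrightarrow> exp (t * R\<^sup>2 / (4 * \<gamma>))" by (rule tendsto_exp)
qed simp

end

lemma (in stationary_jump_process) hoeffding_bound:
  assumes gap: "ereal \<gamma> \<le> spectral_gap P \<pi>" and \<gamma>: "0 < \<gamma>" and t: "0 < t" and \<epsilon>: "0 < \<epsilon>" and ab: "a < b"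
    and g: "g \<in> borel_measurable borel" "\<And>x. g x \<in> {a..b}"
  shows "prob {\<omega> \<in> space M. 1 / t * (LBINT s:{0..t}. g (X s \<omega>)) - (\<integral>x. g x \<partial>\<pi>) \<ge> \<epsilon>}
    \<le> exp (- (\<gamma> * t * \<epsilon>\<^sup>2 / (b - a)\<^sup>2))"
proof -
  define m where "m = (\<integral>x. g x \<partial>\<pi>)"
  \<comment> \<open>The minimizer of \<open>t \<theta>\<^sup>2 (b - a)\<^sup>2 / (4 \<gamma>) - \<theta> t \<epsilon>\<close>.\<close>
  define \<theta> where "\<theta> = 2 * \<gamma> * \<epsilon> / (b - a)\<^sup>2"
  define G where "G = (\<lambda>x. \<theta> * (g x - m))"
  define J where "J = (\<lambda>\<omega>. LBINT s:{0..t}. G (X s \<omega>))"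
  have \<theta>: "0 < \<theta>" using \<gamma> \<epsilon> ab by (simp add: \<theta>_def)
  have bg: "\<bar>g x\<bar> \<le> \<bar>a\<bar> + \<bar>b\<bar>" for x using g(2)[of x] by auto
  have mG: "G \<in> borel_measurable borel" using g(1) by (simp add: G_def)
  have rG: "G x \<in> {\<theta> * (a - m)..\<theta> * (a - m) + \<theta> * (b - a)}" for x
    using g(2)[of x] \<theta> by (simp add: G_def distrib_left[symmetric])
  have zG: "(\<integral>x. G x \<partial>\<pi>) = 0"
    using integrable_stationary[OF g(1) bg] by (simp add: G_def m_def)
  \<comment> \<open>Clamping times at \<open>0\<close> extends the paths measurably to the whole line.\<close>
  have mXr: "(\<lambda>(s, \<omega>). X (max 0 s) \<omega>) \<in> borel \<Otimes>\<^sub>M M \<rightarrow>\<^sub>M borel"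
    by (intro X_jointly_measurable) auto
  have "(\<lambda>(\<omega>, s). indicator {0..t} s * G (X (max 0 s) \<omega>)) \<in> borel_measurable (M \<Otimes>\<^sub>M lborel)"
  proof -
    have "(\<lambda>(\<omega>, s). X (max 0 s) \<omega>) \<in> M \<Otimes>\<^sub>M lborel \<rightarrow>\<^sub>M borel"
      using mXr by (subst measurable_pair_swap_iff) (simp add: split_def cong: measurable_cong_sets)
    from measurable_compose[OF this mG] have [measurable]: "(\<lambda>z. G (X (max 0 (snd z)) (fst z))) \<in> borel_measurable (M \<Otimes>\<^sub>M lborel)"
      by (simp add: split_def)
    show ?thesis unfolding split_def by measurable
  qed
  then have "(\<lambda>\<omega>. \<integral>s. indicator {0..t} s * G (X (max 0 s) \<omega>) \<partial>lborel) \<in> borel_measurable M"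
    by (rule lborel.borel_measurable_lebesgue_integral)
  also have "(\<lambda>\<omega>. \<integral>s. indicator {0..t} s * G (X (max 0 s) \<omega>) \<partial>lborel) = J"
    unfolding J_def set_lebesgue_integral_def
    by (intro ext Bochner_Integration.integral_cong) (auto simp: indicator_def max_def)
  finally have mJ [measurable]: "J \<in> borel_measurable M" .
  have iG: "set_integrable lborel {0..t} (\<lambda>s. g (X s \<omega>))" if \<omega>: "\<omega> \<in> space M" for \<omega>
  proof -
    have "(\<lambda>s. g (X s \<omega>)) \<in> borel_measurable (restrict_space borel {0..})"
      by (rule measurable_compose[OF X_path_measurable[OF \<omega>] g(1)])
    then have "set_borel_measurable borel {0..} (\<lambda>s. g (X s \<omega>))"
      by (simp add: set_borel_measurable_def borel_measurable_restrict_space_iff)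
    then have "set_borel_measurable borel {0..0+t} (\<lambda>s. g (X s \<omega>))" by (rule set_borel_measurable_subset) auto
    from integral_unif01_affine(1)[OF this _ t, of "\<bar>a\<bar> + \<bar>b\<bar>"] bg show ?thesis by simp
  qed
  have J: "J \<omega> = \<theta> * ((LBINT s:{0..t}. g (X s \<omega>)) - t * m)" if \<omega>: "\<omega> \<in> space M" for \<omega>
  proof -
    have ic: "set_integrable lborel {0..t} (\<lambda>s. m)" using t by (simp add: set_integrable_def)
    have "J \<omega> = \<theta> * (LBINT s:{0..t}. g (X s \<omega>) - m)" by (simp add: J_def G_def)
    also have "(LBINT s:{0..t}. g (X s \<omega>) - m) = (LBINT s:{0..t}. g (X s \<omega>)) - (LBINT s:{0..t}. m)"
      by (rule set_integral_diff(2)[OF iG[OF \<omega>] ic])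
    also have "(LBINT s:{0..t}. m) = t * m" using t by (simp add: set_lebesgue_integral_def)
    finally show ?thesis .
  qed
  have bJ: "\<bar>J \<omega>\<bar> \<le> \<theta> * (t * (\<bar>a\<bar> + \<bar>b\<bar> + \<bar>m\<bar>))" if \<omega>: "\<omega> \<in> space M" for \<omega>
  proof -
    have "\<bar>LBINT s:{0..t}. g (X s \<omega>)\<bar> \<le> (LBINT s:{0..t}. \<bar>a\<bar> + \<bar>b\<bar>)"
      using set_integral_norm_bound[OF iG[OF \<omega>]] set_integral_mono[OF set_integrable_abs[OF iG[OF \<omega>]], of "\<lambda>_. \<bar>a\<bar> + \<bar>b\<bar>"] bg t
      by (simp add: set_integrable_def)
    also have "\<dots> = t * (\<bar>a\<bar> + \<bar>b\<bar>)" using t by (simp add: set_lebesgue_integral_def)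
    finally have "\<bar>(LBINT s:{0..t}. g (X s \<omega>)) - t * m\<bar> \<le> t * (\<bar>a\<bar> + \<bar>b\<bar> + \<bar>m\<bar>)"
      using t abs_triangle_ineq4[of "LBINT s:{0..t}. g (X s \<omega>)" "t * m"] by (simp add: distrib_left abs_mult)
    then show ?thesis using \<theta> by (simp add: J[OF \<omega>] abs_mult)
  qed
  have iE: "integrable M (\<lambda>\<omega>. exp (J \<omega>))"
    using bJ by (intro bounded_integrable[where B="exp (\<theta> * (t * (\<bar>a\<bar> + \<bar>b\<bar> + \<bar>m\<bar>)))"]) (auto simp: abs_le_iff)
  have "{\<omega> \<in> space M. 1 / t * (LBINT s:{0..t}. g (X s \<omega>)) - m \<ge> \<epsilon>} = {\<omega> \<in> space M. exp (J \<omega>) \<ge> exp (\<theta> * (t * \<epsilon>))}"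
  proof (intro Collect_cong conj_cong refl)
    fix \<omega> assume \<omega>: "\<omega> \<in> space M"
    have "1 / t * I - m \<ge> \<epsilon> \<longleftrightarrow> t * \<epsilon> \<le> I - t * m" for I using t by (simp add: field_simps)
    then show "\<epsilon> \<le> 1 / t * (LBINT s:{0..t}. g (X s \<omega>)) - m \<longleftrightarrow> exp (\<theta> * (t * \<epsilon>)) \<le> exp (J \<omega>)"
      by (simp only: J[OF \<omega>] exp_le_cancel_iff mult_le_cancel_left_pos[OF \<theta>])
  qed
  then have "prob {\<omega> \<in> space M. 1 / t * (LBINT s:{0..t}. g (X s \<omega>)) - m \<ge> \<epsilon>} = prob {\<omega> \<in> space M. exp (J \<omega>) \<ge> exp (\<theta> * (t * \<epsilon>))}"
    by simp
  also have "\<dots> \<le> expectation (\<lambda>\<omega>. exp (J \<omega>)) / exp (\<theta> * (t * \<epsilon>))"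
    by (rule integral_Markov_inequality_measure[OF iE sets.top]) auto
  also have "\<dots> \<le> exp (t * (\<theta> * (b - a))\<^sup>2 / (4 * \<gamma>)) / exp (\<theta> * (t * \<epsilon>))"
    using exponential_moment[OF gap \<gamma> t mG rG zG] by (simp add: J_def divide_right_mono)
  also have "\<dots> = exp (t * (\<theta> * (b - a))\<^sup>2 / (4 * \<gamma>) - \<theta> * (t * \<epsilon>))" by (simp add: exp_diff)
  also have "t * (\<theta> * (b - a))\<^sup>2 / (4 * \<gamma>) - \<theta> * (t * \<epsilon>) = - (\<gamma> * t * \<epsilon>\<^sup>2 / (b - a)\<^sup>2)"
  proof -
    define w where "w = b - a"
    have "w \<noteq> 0" using ab by (simp add: w_def)
    then show ?thesis
      unfolding \<theta>_def w_def[symmetric] using \<gamma> by (simp add: power2_eq_square field_simps)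
  qed
  finally show ?thesis by (simp add: m_def)
qed

theorem theorem4p1:
  fixes P :: "real \<Rightarrow> 'e::topological_space \<Rightarrow> 'e measure"
    and \<pi> :: "'e measure"
    and q :: "'e \<Rightarrow> ennreal"
    and Q :: "'e \<Rightarrow> 'e measure"
    and M :: "'w measure"
    and X :: "real \<Rightarrow> 'w \<Rightarrow> 'e"
    and g :: "'e \<Rightarrow> real"
    and a b t \<epsilon> :: real
  assumes "\<And>x::'e. {x} \<in> sets borel"
    and "jump_transition_function P"
    and "irreducible_transition P"
    and "stationary_distribution P \<pi>"
    and "has_q_pair P q Q"
    and "totally_stable q"
    and "conservative q Q"
    and "regular_q_pair q Q"
    and "markov_process M X P \<pi>"
    and "spectral_gap P \<pi> > 0"
    and "finite_support_dense \<pi> Q"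
    and "a < b"
    and "continuous_on UNIV g"
    and "\<And>x. g x \<in> {a..b}"
    and "t > 0"
    and "\<epsilon> > 0"
  shows "ereal (measure M {\<omega> \<in> space M.
             1 / t * (LBINT s:{0..t}. g (X s \<omega>)) - (\<integral>x. g x \<partial>\<pi>) \<ge> \<epsilon>})
         \<le> exp_ereal (- (spectral_gap P \<pi> * ereal t * ereal (\<epsilon>\<^sup>2) / ereal ((b - a)\<^sup>2)))"
proof -
  interpret stationary_jump_process P \<pi> M X
    using assms(1,2,4,9) by unfold_locales
  let ?p = "measure M {\<omega> \<in> space M. 1 / t * (LBINT s:{0..t}. g (X s \<omega>)) - (\<integral>x. g x \<partial>\<pi>) \<ge> \<epsilon>}"
  define c where "c = t * \<epsilon>\<^sup>2 / (b - a)\<^sup>2"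
  have c: "0 < c" using assms by (simp add: c_def)
  have g: "g \<in> borel_measurable borel" using assms(13) by (rule borel_measurable_continuous_onI)
  have bound: "?p \<le> exp (- (\<gamma> * c))" if "ereal \<gamma> \<le> spectral_gap P \<pi>" "0 < \<gamma>" for \<gamma>
    using hoeffding_bound[OF that assms(15,16,12) g assms(14)] by (simp add: c_def mult.assoc)
  show ?thesis
  proof (cases "spectral_gap P \<pi>")
    case (real \<gamma>)
    then show ?thesis using bound[of \<gamma>] assms(10,12)
      by (simp add: exp_ereal_def c_def mult.assoc)
  next
    case PInf
    have "((\<lambda>\<gamma>. exp (- (\<gamma> * c))) \<longlongrightarrow> 0) at_top" using c by real_asymp
    moreover have "eventually (\<lambda>\<gamma>. ?p \<le> exp (- (\<gamma> * c))) at_top"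
      by (rule eventually_mono[OF eventually_gt_at_top[of 0]]) (rule bound, simp_all add: PInf)
    ultimately have "?p \<le> 0" by (intro tendsto_lowerbound) auto
    moreover have "exp_ereal (- (spectral_gap P \<pi> * ereal t * ereal (\<epsilon>\<^sup>2) / ereal ((b - a)\<^sup>2))) = 0"
      using PInf assms(12,15,16) by (simp add: exp_ereal_def)
    ultimately show ?thesis by simp
  qed (use assms(10) in simp)
qed

end
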